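(* For every two trees $T_1, T_2$ (each with $\operatorname{diam}(T_i)>0$), we have $$\operatorname{capt}_2(T_1\square T_2) = \left\lfloor \frac{\operatorname{diam}(T_1\square T_2)}{2}\right\rfloor .$$
   Context: All graphs are undirected, simple, finite, and connected. $d(u,v)$ denotes the graph distance and $\operatorname{diam}(G)$ is the maximum distance between two vertices of $G$. The Cartesian product $G\square H$ has vertex set $V(G)\times V(H)$, with $(u_1,v_1)$ and $(u_2,v_2)$ adjacent iff either $u_1=u_2$ and $v_1v_2\in E(H)$, or $v_1=v_2$ and $u_1u_2\in E(G)$. Cops and Robber game with $k$ cops on $G$: players occupy vertices, and several players may occupy the same vertex. In round 0, first each of the $k$ cops chooses a starting vertex, then the robber chooses a starting vertex. In each subsequent round $1,2,\dots$, first each cop moves and then the robber moves; a move of a player consists of staying or going to an adjacent vertex. All positions are known to all players at all times. The game ends and the cops win (the robber is captured) as soon as the robber is at a vertex occupied by some cop. (Letting the robber move before the cops in each round after round 0 does not change the values below, and the paper adopts that convention.) The length of a game is $t$ if the robber is captured in round $t$, and infinite if she is never captured. The $k$-capture time $\operatorname{capt}_k(G)$ is the length of an optimal game: the least $t$ such that $k$ cops have a strategy (including the choice of starting vertices) guaranteeing capture in round at most $t$, whatever the robber does (infinite if there is no such $t$). *)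

theory Defs
  imports "Graph_Theory.Digraph_Component" "HOL-Library.Extended_Nat"
begin

text \<open>
  A finite simple undirected graph is a symmetric digraph without loops and parallel arcs, that is,
  a \<^typ>\<open>'a pair_pre_digraph\<close> satisfying \<^locale>\<open>pair_graph\<close>: an edge \<open>uv\<close> is the pair of arcs
  \<open>(u, v)\<close>, \<open>(v, u)\<close>. Connectedness, \<^const>\<open>Digraph_Component.connected\<close>, includes that the graph
  has at least one vertex.
\<close>

text \<open>
  The closed walk \<open>u, v, u\<close> is a cycle in the sense of \<^const>\<open>pre_digraph.cycle\<close>, so the predicates
  \<^const>\<open>forest\<close> and \<^const>\<open>tree\<close> are not usable for undirected graphs. In a simple graph, the
  undirected cycles are precisely the cycles of length at least 3.
\<close>

definition undirected_tree :: "'a pair_pre_digraph \<Rightarrow> bool" where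
  "undirected_tree G \<longleftrightarrow> pair_graph G \<and> Digraph_Component.connected (with_proj G)
     \<and> \<not> (\<exists>p. pre_digraph.cycle (with_proj G) p \<and> 3 \<le> length p)"

text \<open>Distance and diameter are only meaningful for finite connected graphs.\<close>

definition graph_dist :: "'a pair_pre_digraph \<Rightarrow> 'a \<Rightarrow> 'a \<Rightarrow> nat" where
  "graph_dist G u v = (LEAST n. \<exists>p. pre_digraph.awalk (with_proj G) u p v \<and> length p = n)"

definition diam :: "'a pair_pre_digraph \<Rightarrow> nat" where
  "diam G = Max {graph_dist G u v | u v. u \<in> pverts G \<and> v \<in> pverts G}"

definition cart_prod :: "'a pair_pre_digraph \<Rightarrow> 'b pair_pre_digraph \<Rightarrow> ('a \<times> 'b) pair_pre_digraph"
    (infixr \<open>\<box>\<close> 70) where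
  "G \<box> H = \<lparr> pverts = pverts G \<times> pverts H,
     parcs = {((u1, v1), (u2, v2)) | u1 v1 u2 v2.
       (u1 \<in> pverts G \<and> u1 = u2 \<and> (v1, v2) \<in> parcs H) \<or>
       (v1 \<in> pverts H \<and> v1 = v2 \<and> (u1, u2) \<in> parcs G)} \<rparr>"

definition legal_move :: "'a pair_pre_digraph \<Rightarrow> 'a \<Rightarrow> 'a \<Rightarrow> bool" where
  "legal_move G u v \<longleftrightarrow> u = v \<or> (u, v) \<in> parcs G"

text \<open>
  \<open>r n\<close> is the robber's vertex at the end of round \<open>n\<close>. Plays are infinite: play formally goes on after
  a capture, but only the first capture matters below.
\<close>

definition robber_play :: "'a pair_pre_digraph \<Rightarrow> (nat \<Rightarrow> 'a) \<Rightarrow> bool" where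
  "robber_play G r \<longleftrightarrow> (\<forall>n. r n \<in> pverts G \<and> legal_move G (r n) (r (Suc n)))"

text \<open>
  A strategy \<open>\<sigma>\<close> of the cops maps the robber's vertices in rounds \<open>0, \<dots>, n - 1\<close> to the list of the cops'
  vertices in round \<open>n\<close>, so \<open>\<sigma> []\<close> is the initial placement. As \<open>\<sigma>\<close> determines all earlier positions of
  the cops as well, this captures every strategy with full information and memory.
\<close>

definition cops_at :: "('a list \<Rightarrow> 'a list) \<Rightarrow> (nat \<Rightarrow> 'a) \<Rightarrow> nat \<Rightarrow> 'a list" where
  "cops_at \<sigma> r n = \<sigma> (map r [0..<n])"

definition cop_strategy :: "'a pair_pre_digraph \<Rightarrow> nat \<Rightarrow> ('a list \<Rightarrow> 'a list) \<Rightarrow> bool" where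
  "cop_strategy G k \<sigma> \<longleftrightarrow> (\<forall>r. robber_play G r \<longrightarrow> (\<forall>n.
     length (cops_at \<sigma> r n) = k \<and> set (cops_at \<sigma> r n) \<subseteq> pverts G \<and>
     (\<forall>i<k. legal_move G (cops_at \<sigma> r n ! i) (cops_at \<sigma> r (Suc n) ! i))))"

text \<open>
  In round \<open>t > 0\<close> the cops move first, so the robber is captured either by the cops' move, while she is
  still at \<open>r (t - 1)\<close>, or by her own move onto a cop.
\<close>

definition captured_in_round :: "('a list \<Rightarrow> 'a list) \<Rightarrow> (nat \<Rightarrow> 'a) \<Rightarrow> nat \<Rightarrow> bool" where
  "captured_in_round \<sigma> r t \<longleftrightarrow>
     (0 < t \<and> r (t - 1) \<in> set (cops_at \<sigma> r t)) \<or> r t \<in> set (cops_at \<sigma> r t)"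

definition cops_capture_within :: "'a pair_pre_digraph \<Rightarrow> nat \<Rightarrow> nat \<Rightarrow> bool" where
  "cops_capture_within G k t \<longleftrightarrow> (\<exists>\<sigma>. cop_strategy G k \<sigma> \<and>
     (\<forall>r. robber_play G r \<longrightarrow> (\<exists>s\<le>t. captured_in_round \<sigma> r s)))"

text \<open>The infimum of the empty set in \<^typ>\<open>enat\<close> is \<open>\<infinity>\<close>.\<close>

definition capture_time :: "nat \<Rightarrow> 'a pair_pre_digraph \<Rightarrow> enat" where
  "capture_time k G = Inf {enat t | t. cops_capture_within G k t}"

end

theory Submission
  imports Defs
begin

text \<open>
  Upper bound: two cops start on adjacent vertices of eccentricity at most \<open>m + 1\<close>, where \<open>m\<close> is half the
  diameter, rounded down. Each of them always decreases the larger of its two coordinate distances to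
  the robber. A cop at even distance after its move never has to step back towards its start while the
  robber keeps moving, so that after \<open>k\<close> rounds without capture the robber is at distance at least
  \<open>k + 2\<close> from the start of that cop. The other cop is at odd distance; a pass of the robber
  exchanges the parities, and unless the robber is captured at once, the other cop takes over.

  Lower bound: the robber plays in the grid spanned by diametral paths of the two trees. The distances
  of a vertex from two opposite corners of the grid add up to at least the diameter, so some corner has
  distances from the two cops that sum up to at least the diameter. The robber waits in that corner. When
  one cop arrives next to it, she leaves through the other exit and runs towards the second cop, whom
  she meets no earlier than after half of the remaining sum of distances.
\<close>

section \<open>Distances in graphs and trees\<close>

text \<open>Together with \<open>relpow_pcas\<close>, this turns arc lists into powers of the arc
  relation: distances become least exponents, and walks are concatenated by
  \<open>relpow_add\<close>.\<close>

lemma pcas_relpow: "pcas u p v \<Longrightarrow> set p \<subseteq> E \<Longrightarrow> (u, v) \<in> E ^^ length p"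
proof (induction p arbitrary: u)
  case (Cons e p)
  then show ?case
    by (cases e) (auto simp del: relpow.simps intro: relpow_Suc_I2)
qed auto

lemma relpow_pcas: "(u, v) \<in> E ^^ n \<Longrightarrow> \<exists>p. set p \<subseteq> E \<and> length p = n \<and> pcas u p v"
proof (induction n arbitrary: u)
  case (Suc n)
  then obtain w where w: "(u, w) \<in> E" "(w, v) \<in> E ^^ n"
    by (meson relpow_Suc_D2)
  with Suc.IH obtain p where "set p \<subseteq> E \<and> length p = n \<and> pcas w p v"
    by blast
  with w(1) show ?case
    by (intro exI[of _ "(u, w) # p"]) auto
qed auto

context pair_wf_digraph
begin

lemma exists_awalk_length_iff:
  assumes "u \<in> pverts G"
  shows "(\<exists>p. awalk u p v \<and> length p = n) \<longleftrightarrow> (u, v) \<in> parcs G ^^ n"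
  using assms relpow_pcas[of u v n "parcs G"] pcas_relpow[of u _ v "parcs G"]
  by (auto simp: awalk_def)

lemma graph_dist_conv: "u \<in> pverts G \<Longrightarrow> graph_dist G u v = (LEAST n. (u, v) \<in> parcs G ^^ n)"
  by (simp add: graph_dist_def exists_awalk_length_iff)

lemma graph_dist_le: "u \<in> pverts G \<Longrightarrow> (u, v) \<in> parcs G ^^ n \<Longrightarrow> graph_dist G u v \<le> n"
  by (simp add: graph_dist_conv Least_le)

text \<open>Descending along \<open>step\<close> yields a walk of length \<open>\<delta> u\<close>,
  and by \<open>edge\<close> no walk to \<open>v\<close> is shorter. In the product, the potential
  will be the sum of the coordinate distances.\<close>

lemma graph_dist_eqI:
  fixes \<delta> :: "'a \<Rightarrow> nat"
  assumes V: "u \<in> pverts G" "v \<in> pverts G"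
    and zero: "\<delta> v = 0"
    and edge: "\<And>x y. (x, y) \<in> parcs G \<Longrightarrow> \<delta> x \<le> Suc (\<delta> y)"
    and step: "\<And>x. x \<in> pverts G \<Longrightarrow> x \<noteq> v \<Longrightarrow> \<exists>y. (x, y) \<in> parcs G \<and> \<delta> x = Suc (\<delta> y)"
  shows "graph_dist G u v = \<delta> u"
proof (rule antisym)
  have "(x, v) \<in> parcs G ^^ \<delta> x" if "x \<in> pverts G" for x
    using that
  proof (induction "\<delta> x" arbitrary: x)
    case 0
    then have "x = v" using step by fastforce
    then show ?case using zero by simp
  next
    case (Suc n)
    then have "x \<noteq> v" using zero by auto
    with step Suc.prems obtain y where y: "(x, y) \<in> parcs G" "\<delta> x = Suc (\<delta> y)"
      by blast
    then have "(y, v) \<in> parcs G ^^ \<delta> y"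
      using Suc.hyps in_arcsD2 by auto
    with y show ?case by (auto simp del: relpow.simps intro: relpow_Suc_I2)
  qed
  from this[OF V(1)] have reach: "(u, v) \<in> parcs G ^^ \<delta> u" .
  then show "graph_dist G u v \<le> \<delta> u"
    using V graph_dist_le by blast
  have "\<delta> x \<le> n" if "(x, v) \<in> parcs G ^^ n" for x n
    using that
  proof (induction n arbitrary: x)
    case (Suc n)
    then show ?case
      by (meson edge le_trans not_less_eq_eq relpow_Suc_D2)
  qed (use zero in auto)
  moreover have "(u, v) \<in> parcs G ^^ graph_dist G u v"
    using reach V(1) by (auto simp: graph_dist_conv intro: LeastI)
  ultimately show "\<delta> u \<le> graph_dist G u v"
    by blast
qed

end

section \<open>Distances and geodesics in finite connected graphs\<close>

locale connected_pair_graph = pair_graph +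
  assumes connected_graph: "Digraph_Component.connected (with_proj G)"
begin

lemma parcs_sym: "(u, v) \<in> parcs G \<Longrightarrow> (v, u) \<in> parcs G"
  using pair_sym_arcs by (auto simp: symmetric_def dest: symD)

lemma parcs_irrefl: "(u, v) \<in> parcs G \<Longrightarrow> u \<noteq> v"
  using pair_no_loops by fastforce

lemma pverts_nonempty: "pverts G \<noteq> {}"
  using connected_graph
  by (auto simp: Digraph_Component.connected_def strongly_connected_def mk_symmetric_def)

lemma exists_relpow:
  assumes "u \<in> pverts G" "v \<in> pverts G"
  shows "\<exists>n. (u, v) \<in> parcs G ^^ n"
proof -
  have "parcs (mk_symmetric (with_proj G)) = parcs G"
    using parcs_sym by (auto simp: mk_symmetric_def)
  then have "(u, v) \<in> rtrancl_on (pverts G) (parcs G)"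
    using connected_graph assms
    by (auto simp: Digraph_Component.connected_def strongly_connected_def mk_symmetric_def
        reachable_def)
  then have "(u, v) \<in> (parcs G)\<^sup>*"
    by (rule rtrancl_on_rtranclI)
  then show ?thesis
    by (simp add: rtrancl_power)
qed

lemma graph_dist_relpow:
  assumes "u \<in> pverts G" "v \<in> pverts G"
  shows "(u, v) \<in> parcs G ^^ graph_dist G u v"
  using exists_relpow[OF assms] assms(1) by (auto simp: graph_dist_conv intro: LeastI)

lemma graph_dist_refl [simp]: "u \<in> pverts G \<Longrightarrow> graph_dist G u u = 0"
  using graph_dist_le[of u u 0] by simp

lemma graph_dist_eq_0_iff [simp]:
  "u \<in> pverts G \<Longrightarrow> v \<in> pverts G \<Longrightarrow> graph_dist G u v = 0 \<longleftrightarrow> u = v"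
  using graph_dist_relpow[of u v] by auto

lemma graph_dist_triangle:
  assumes "u \<in> pverts G" "v \<in> pverts G" "w \<in> pverts G"
  shows "graph_dist G u w \<le> graph_dist G u v + graph_dist G v w"
  using graph_dist_relpow[of u v] graph_dist_relpow[of v w] assms
  by (intro graph_dist_le) (auto simp: relpow_add)

lemma relpow_sym:
 "(u, v) \<in> parcs G ^^ n \<Longrightarrow> (v, u) \<in> parcs G ^^ n"
proof (induction n arbitrary: v)
  case (Suc n)
  then show ?case
    by (metis parcs_sym relpow_Suc_E relpow_Suc_I2)
qed auto

lemma graph_dist_sym:
  "u \<in> pverts G \<Longrightarrow> v \<in> pverts G \<Longrightarrow> graph_dist G u v = graph_dist G v u"
  by (meson antisym graph_dist_le graph_dist_relpow relpow_sym)

lemma graph_dist_edge: "(u, v) \<in> parcs G \<Longrightarrow> graph_dist G u v = 1"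
  using graph_dist_le[of u v 1] graph_dist_eq_0_iff[of u v] parcs_irrefl[of u v]
    in_arcsD1[of u v] in_arcsD2[of u v]
  by (simp add: le_Suc_eq)

lemma graph_dist_step:
  assumes "u \<in> pverts G" "v \<in> pverts G" "u \<noteq> v"
  shows "\<exists>w. (u, w) \<in> parcs G \<and> graph_dist G u v = Suc (graph_dist G w v)"
proof -
  obtain n where n: "graph_dist G u v = Suc n"
    using graph_dist_eq_0_iff[OF assms(1,2)] assms(3) not0_implies_Suc by blast
  then obtain w where w: "(u, w) \<in> parcs G" "(w, v) \<in> parcs G ^^ n"
    using graph_dist_relpow[OF assms(1,2)] by (metis relpow_Suc_D2)
  then have wV: "w \<in> pverts G" using in_arcsD2 by blast
  then have "graph_dist G w v \<le> n" using graph_dist_le w by blast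
  moreover have "graph_dist G u v \<le> Suc (graph_dist G w v)"
    using graph_dist_triangle[OF assms(1) wV assms(2)] graph_dist_edge[OF w(1)] by simp
  ultimately show ?thesis using w n by auto
qed

lemma graph_dist_edge_le:
  assumes "(x, y) \<in> parcs G" "z \<in> pverts G"
  shows "graph_dist G z y \<le> Suc (graph_dist G z x)"
  using graph_dist_triangle[of z x y] graph_dist_edge[of x y] assms in_arcsD1 in_arcsD2 by fastforce

lemma finite_dist_set: "finite {graph_dist G u v | u v. u \<in> pverts G \<and> v \<in> pverts G}"
proof -
  have "{graph_dist G u v | u v. u \<in> pverts G \<and> v \<in> pverts G}
    = (\<lambda>(u, v). graph_dist G u v) ` (pverts G \<times> pverts G)" by auto
  then show ?thesis using pair_finite_verts by simp
qed

lemma graph_dist_le_diam: "u \<in> pverts G \<Longrightarrow> v \<in> pverts G \<Longrightarrow> graph_dist G u v \<le> diam G"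
  unfolding diam_def by (rule Max_ge[OF finite_dist_set]) auto

lemma diam_attained: "\<exists>u v. u \<in> pverts G \<and> v \<in> pverts G \<and> graph_dist G u v = diam G"
proof -
  have "diam G \<in> {graph_dist G u v | u v. u \<in> pverts G \<and> v \<in> pverts G}"
    unfolding diam_def by (rule Max_in[OF finite_dist_set]) (use pverts_nonempty in auto)
  then show ?thesis by (auto simp: eq_commute)
qed

text \<open>A step that approaches \<open>v\<close> must lead away from \<open>u\<close>, since
  otherwise a walk through \<open>w\<close> would be shorter than the distance from \<open>u\<close>
  to \<open>v\<close>.\<close>

lemma geodesic_step:
  assumes "u \<in> pverts G" "v \<in> pverts G" "x \<in> pverts G" "x \<noteq> v"
    and geo: "graph_dist G u v = graph_dist G u x + graph_dist G x v"
  shows "\<exists>w. (x, w) \<in> parcs G \<and> graph_dist G u w = Suc (graph_dist G u x)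
    \<and> graph_dist G u v = graph_dist G u w + graph_dist G w v"
proof -
  obtain w where w: "(x, w) \<in> parcs G" "graph_dist G x v = Suc (graph_dist G w v)"
    using graph_dist_step assms by blast
  then have wV: "w \<in> pverts G" using in_arcsD2 by blast
  then show ?thesis
    using w graph_dist_triangle[OF assms(1) wV assms(2)] graph_dist_edge_le[OF w(1) assms(1)] geo
    by (intro exI[of _ w]) auto
qed

lemma exists_between:
  assumes "u \<in> pverts G" "v \<in> pverts G" "k \<le> graph_dist G u v"
  shows "\<exists>w \<in> pverts G. graph_dist G u w = k \<and> graph_dist G u v = graph_dist G u w + graph_dist G w v"
  using assms(3)
proof (induction k)
  case 0
  then show ?case using assms by (intro bexI[of _ u]) auto
next
  case (Suc k)
  then obtain w where w: "w \<in> pverts G" "graph_dist G u w = k"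
    "graph_dist G u v = graph_dist G u w + graph_dist G w v" by auto
  then have "w \<noteq> v" using Suc.prems assms by auto
  then obtain x where "(w, x) \<in> parcs G" "graph_dist G u x = Suc k"
    "graph_dist G u v = graph_dist G u x + graph_dist G x v"
    using geodesic_step[OF assms(1,2) w(1)] w by auto
  then show ?case using in_arcsD2 by blast
qed

end

section \<open>Geodesics and central edges in trees\<close>

locale tree_graph = connected_pair_graph +
  assumes acyclic_graph: "\<not> (\<exists>p. cycle p \<and> 3 \<le> length p)"
begin

text \<open>A path from \<open>y1\<close> to \<open>y2\<close> that avoids \<open>x\<close> would
  close up through \<open>x\<close> to a cycle. All later tree arguments draw on acyclicity through
  this fact.\<close>

lemma no_detour:
  assumes "(x, y1) \<in> parcs G" "(x, y2) \<in> parcs G"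
    and path: "(y1, y2) \<in> {(a, b) \<in> parcs G. a \<noteq> x \<and> b \<noteq> x}\<^sup>*"
  shows "y1 = y2"
proof (rule ccontr)
  assume "y1 \<noteq> y2"
  \<comment> \<open>Deleting \<open>x\<close> gives a digraph in which \<open>awalk_to_apath\<close>
    shortens the walk to a path.\<close>
  define H where "H = \<lparr> pverts = pverts G - {x}, parcs = {(a, b) \<in> parcs G. a \<noteq> x \<and> b \<noteq> x} \<rparr>"
  interpret H: pair_wf_digraph H
    by unfold_locales (auto simp: H_def dest: in_arcsD1 in_arcsD2)
  have "y1 \<in> pverts H"
    using assms parcs_irrefl in_arcsD2 by (auto simp: H_def)
  moreover have "(y1, y2) \<in> (parcs H)\<^sup>*"
    using path by (simp add: H_def)
  ultimately obtain p where "H.awalk y1 p y2"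
    using relpow_pcas[of y1 y2 _ "parcs H"] by (auto simp: H.awalk_def rtrancl_power)
  then have "H.apath y1 (H.awalk_to_apath p) y2"
    by (rule H.apath_awalk_to_apath)
  then obtain q where q: "H.awalk y1 q y2" "distinct (pawalk_verts y1 q)"
    by (auto simp: H.apath_def)
  have sub: "set (pawalk_verts y1 q) \<subseteq> pverts G - {x}" "set q \<subseteq> parcs G" "pcas y1 q y2"
    using H.awalkE[OF q(1)] by (auto simp: H_def)
  have "q \<noteq> []" using sub \<open>y1 \<noteq> y2\<close> by auto
  have verts: "pawalk_verts u (r @ [(y2, x)]) = pawalk_verts u r @ [x]" if "pcas u r y2" for u r
    using that by (induction r arbitrary: u) auto
  have cas: "pcas u (r @ [(y2, x)]) x" if "pcas u r y2" for u r
    using that by (induction r arbitrary: u) auto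
  let ?c = "(x, y1) # q @ [(y2, x)]"
  have "awalk x ?c x"
    using sub assms parcs_sym in_arcsD1 cas by (auto simp: awalk_def)
  moreover have "distinct (tl (pawalk_verts x ?c))"
    using verts sub q by auto
  ultimately have "cycle ?c"
    by (auto simp: cycle_def)
  moreover have "3 \<le> length ?c"
    using \<open>q \<noteq> []\<close> by (cases q) auto
  ultimately show False using acyclic_graph by blast
qed

text \<open>A geodesic from such a neighbour to \<open>s\<close> never meets \<open>x\<close>,
  because its later vertices are strictly closer to \<open>s\<close> than \<open>x\<close> is. So
  two such neighbours would be joined by a detour around \<open>x\<close>.\<close>

lemma closer_neighbour_unique:
  assumes "(x, y1) \<in> parcs G" "(x, y2) \<in> parcs G" "s \<in> pverts G"
    and "graph_dist G y1 s \<le> graph_dist G x s" "graph_dist G y2 s \<le> graph_dist G x s"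
  shows "y1 = y2"
proof -
  let ?E = "{(a, b) \<in> parcs G. a \<noteq> x \<and> b \<noteq> x}"
  have path: "(y, s) \<in> ?E\<^sup>*" if "y \<in> pverts G" "y \<noteq> x" "graph_dist G y s \<le> graph_dist G x s" for y
    using that
  proof (induction "graph_dist G y s" arbitrary: y)
    case 0
    then show ?case using assms(3) by simp
  next
    case (Suc n)
    then have "y \<noteq> s" using assms(3) by auto
    then obtain w where w: "(y, w) \<in> parcs G" "graph_dist G y s = Suc (graph_dist G w s)"
      using graph_dist_step Suc.prems assms(3) by blast
    then have "w \<noteq> x" "w \<in> pverts G" using Suc.prems in_arcsD2 by auto
    with w Suc have "(w, s) \<in> ?E\<^sup>*" by auto
    then show ?case using w \<open>w \<noteq> x\<close> Suc.prems by (auto intro: converse_rtrancl_into_rtrancl)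
  qed
  have "sym ?E" using parcs_sym by (auto intro!: symI)
  have p1: "(y1, s) \<in> ?E\<^sup>*" and p2: "(y2, s) \<in> ?E\<^sup>*"
    using path[of y1] path[of y2] assms parcs_irrefl in_arcsD2 by blast+
  from \<open>sym ?E\<close> have "(y1, y2) \<in> ?E\<^sup>*"
    using rtrancl_trans[OF p1 symD[OF sym_rtrancl p2]] by blast
  then show ?thesis using no_detour assms by blast
qed

text \<open>If both ends were equally far from \<open>z\<close>, then \<open>y\<close> would
  coincide with the neighbour of \<open>x\<close> that is strictly closer to
  \<open>z\<close>.\<close>

lemma graph_dist_edge_cases:
  assumes "(x, y) \<in> parcs G" "z \<in> pverts G"
  shows "graph_dist G z y = Suc (graph_dist G z x) \<or> graph_dist G z x = Suc (graph_dist G z y)"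
proof -
  have xV: "x \<in> pverts G" and yV: "y \<in> pverts G" using assms in_arcsD1 in_arcsD2 by auto
  have "graph_dist G z x \<noteq> graph_dist G z y"
  proof
    assume eq: "graph_dist G z x = graph_dist G z y"
    then have "x \<noteq> z" using xV yV assms parcs_irrefl by auto
    then obtain w where w: "(x, w) \<in> parcs G" "graph_dist G x z = Suc (graph_dist G w z)"
      using graph_dist_step xV assms(2) by blast
    have "w = y"
      by (rule closer_neighbour_unique[OF w(1) assms])
         (use w eq xV yV assms graph_dist_sym in auto)
    then show False using w eq graph_dist_sym xV yV assms by simp
  qed
  then show ?thesis
    using graph_dist_edge_le[OF assms] graph_dist_edge_le[OF parcs_sym[OF assms(1)] assms(2)]
    by linarith
qed

text \<open>The robber cannot get behind a cop at \<open>a\<close> between \<open>s\<close> and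
  \<open>r\<close>: a neighbour of \<open>r\<close> nearer to \<open>s\<close> is also the one
  nearer to \<open>a\<close>. For \<open>a = r\<close>, a step back towards \<open>s\<close> would
  break the geodesic.\<close>

lemma geodesic_extend:
  assumes "s \<in> pverts G" "a \<in> pverts G" "(r, r') \<in> parcs G" "a \<noteq> r"
    and geo: "graph_dist G s r = graph_dist G s a + graph_dist G a r"
  shows "graph_dist G s r' = graph_dist G s a + graph_dist G a r'"
proof -
  have rV: "r \<in> pverts G" and r'V: "r' \<in> pverts G" using assms in_arcsD1 in_arcsD2 by auto
  note V = assms(1,2) rV r'V
  show ?thesis
  proof (cases "graph_dist G s r' = Suc (graph_dist G s r)")
    case True
    then show ?thesis
      using graph_dist_triangle[OF V(1,2,4)] graph_dist_edge_le[OF assms(3,2)] geo by simp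
  next
    case False
    then have closer: "graph_dist G s r = Suc (graph_dist G s r')"
      using graph_dist_edge_cases[OF assms(3,1)] by blast
    obtain w where w: "(r, w) \<in> parcs G" "graph_dist G r a = Suc (graph_dist G w a)"
      using graph_dist_step[of r a] V assms(4) by blast
    then have wV: "w \<in> pverts G" using in_arcsD2 by blast
    have "w = r'"
      by (rule closer_neighbour_unique[OF w(1) assms(3,1)])
         (use w closer geo V wV graph_dist_sym graph_dist_triangle[OF V(1,2) wV] in auto)
    then show ?thesis using w closer geo V graph_dist_sym by auto
  qed
qed

text \<open>The first edge out of \<open>c\<close> cannot approach both \<open>p\<close> and
  \<open>q\<close>, as this would shorten their distance. From there on,
  \<open>geodesic_extend\<close> carries the choice of the end outwards.\<close>

lemma geodesic_through_center:
  assumes "p \<in> pverts G" "q \<in> pverts G" "c \<in> pverts G" "x \<in> pverts G"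
    and geo: "graph_dist G p q = graph_dist G p c + graph_dist G c q"
  shows "graph_dist G p x = graph_dist G p c + graph_dist G c x
    \<or> graph_dist G q x = graph_dist G q c + graph_dist G c x"
  using assms(4)
proof (induction "graph_dist G c x" arbitrary: x)
  case 0
  then show ?case using assms by simp
next
  case (Suc n)
  then have "x \<noteq> c" using assms(3) by auto
  then obtain w where w: "(x, w) \<in> parcs G" "graph_dist G x c = Suc (graph_dist G w c)"
    using graph_dist_step Suc.prems assms(3) by blast
  then have wx: "(w, x) \<in> parcs G" and wV: "w \<in> pverts G"
    using parcs_sym in_arcsD2 by auto
  have IH: "graph_dist G p w = graph_dist G p c + graph_dist G c w
    \<or> graph_dist G q w = graph_dist G q c + graph_dist G c w"
    using Suc.hyps(1)[of w] Suc.hyps(2) w(2) wV assms(3) graph_dist_sym[of c x] graph_dist_sym[of c w]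
      Suc.prems by simp
  show ?case
  proof (cases "w = c")
    case False
    then show ?thesis
      using IH geodesic_extend[of p c w x] geodesic_extend[of q c w x] wx assms by auto
  next
    case True
    have "graph_dist G p q \<le> graph_dist G p x + graph_dist G q x"
      using graph_dist_triangle[of p x q] graph_dist_sym[of x q] Suc.prems assms by simp
    moreover have "graph_dist G c x = 1" using True wx graph_dist_edge by simp
    moreover have "graph_dist G p x = Suc (graph_dist G p c) \<or> graph_dist G p c = Suc (graph_dist G p x)"
      "graph_dist G q x = Suc (graph_dist G q c) \<or> graph_dist G q c = Suc (graph_dist G q x)"
      using graph_dist_edge_cases wx True assms by auto
    moreover have "graph_dist G c q = graph_dist G q c" using graph_dist_sym assms by blast
    ultimately show ?thesis using geo by linarith
  qed
qed

text \<open>Here \<open>c\<close> is a midpoint of a diametral path and \<open>c'\<close> the next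
  vertex on it. For odd diameter the two bounds agree; for even diameter that of \<open>c'\<close>
  is larger by one.\<close>

lemma exists_center_edge:
  assumes "diam G > 0"
  shows "\<exists>c c'. (c, c') \<in> parcs G
    \<and> (\<forall>x \<in> pverts G. graph_dist G c x \<le> (diam G + 1) div 2 \<and> graph_dist G c' x \<le> diam G div 2 + 1)"
proof -
  obtain p q where pq: "p \<in> pverts G" "q \<in> pverts G" "graph_dist G p q = diam G"
    using diam_attained by blast
  have "diam G div 2 \<le> graph_dist G p q" using pq(3) by simp
  from exists_between[OF pq(1,2) this] obtain c where c: "c \<in> pverts G"
    "graph_dist G p c = diam G div 2" "graph_dist G p q = graph_dist G p c + graph_dist G c q"
    by blast
  have "c \<noteq> q" using assms pq(3) c(2) by auto
  then obtain c' where c': "(c, c') \<in> parcs G" "graph_dist G c q = Suc (graph_dist G c' q)"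
    using graph_dist_step c(1) pq(2) by blast
  then have c'V: "c' \<in> pverts G" using in_arcsD2 by blast
  have geo': "graph_dist G p q = graph_dist G p c' + graph_dist G c' q"
    "graph_dist G p c' = diam G div 2 + 1"
    using graph_dist_triangle[OF pq(1) c'V pq(2)] graph_dist_edge_le[OF c'(1) pq(1)] c(2,3) c'(2)
    by linarith+
  \<comment> \<open>By \<open>geodesic_through_center\<close>, \<open>e\<close> lies between
    \<open>x\<close> and one end of the diametral path. That end is at most \<open>diam G\<close>
    away from \<open>x\<close>, so \<open>x\<close> is no farther from \<open>e\<close> than the
    other end is.\<close>
  have ecc: "graph_dist G e x \<le> max (graph_dist G p e) (graph_dist G e q)"
    if "e \<in> pverts G" "x \<in> pverts G" "graph_dist G p q = graph_dist G p e + graph_dist G e q" for e x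
    using geodesic_through_center[OF pq(1,2) that] graph_dist_le_diam[of p x] graph_dist_le_diam[of q x]
      graph_dist_sym[of q e] that pq by linarith
  have "graph_dist G c x \<le> (diam G + 1) div 2 \<and> graph_dist G c' x \<le> diam G div 2 + 1"
    if x: "x \<in> pverts G" for x
    using ecc[OF c(1) x c(3)] c(2,3) ecc[OF c'V x geo'(1)] geo' pq(3) by linarith
  then show ?thesis using c'(1) by blast
qed

end

lemma undirected_tree_iff: "undirected_tree G \<longleftrightarrow> tree_graph G"
  by (auto simp: undirected_tree_def tree_graph_def tree_graph_axioms_def
      connected_pair_graph_def connected_pair_graph_axioms_def)

section \<open>The game with a bounded number of rounds\<close>

definition cops_move :: "'a pair_pre_digraph \<Rightarrow> 'a list \<Rightarrow> 'a list \<Rightarrow> bool" where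
  "cops_move G c c' \<longleftrightarrow> length c' = length c \<and> set c' \<subseteq> pverts G
     \<and> (\<forall>i<length c. legal_move G (c ! i) (c' ! i))"

text \<open>The cops are to move and have \<open>t\<close> more rounds; the robber is at \<open>r\<close>.\<close>

primrec cops_win :: "'a pair_pre_digraph \<Rightarrow> nat \<Rightarrow> 'a list \<Rightarrow> 'a \<Rightarrow> bool" where
  "cops_win G 0 c r \<longleftrightarrow> r \<in> set c"
| "cops_win G (Suc t) c r \<longleftrightarrow> r \<in> set c \<or>
     (\<exists>c'. cops_move G c c' \<and>
       (r \<in> set c' \<or> (\<forall>r' \<in> pverts G. legal_move G r r' \<longrightarrow> cops_win G t c' r')))"

lemma cops_win_captured: "r \<in> set c \<Longrightarrow> cops_win G t c r"
  by (cases t) auto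

lemma legal_move_refl [simp]: "legal_move G u u"
  by (simp add: legal_move_def)

lemma cops_move_refl: "set c \<subseteq> pverts G \<Longrightarrow> cops_move G c c"
  by (simp add: cops_move_def)

lemma cops_at_0 [simp]: "cops_at \<sigma> r 0 = \<sigma> []"
  by (simp add: cops_at_def)

text \<open>The strategy is assembled from winning replies to single positions, with the number of
  remaining rounds as part of the state.\<close>

lemma cops_capture_within_if_cops_win:
  assumes "length c = k" "set c \<subseteq> pverts G"
    and win: "\<And>r. r \<in> pverts G \<Longrightarrow> cops_win G t c r"
  shows "cops_capture_within G k t"
proof -
  define good where "good n d r d' \<longleftrightarrow> cops_move G d d' \<and>
    (r \<in> set d' \<or> (\<forall>r' \<in> pverts G. legal_move G r r' \<longrightarrow> cops_win G n d' r'))" for n d r d'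
  \<comment> \<open>After a capture or after the last round no good reply need exist. Standing still
    keeps the strategy legal there, as \<open>cop_strategy\<close> demands for infinite
    plays.\<close>
  define reply where "reply n d r = (if \<exists>d'. good n d r d' then SOME d'. good n d r d' else d)" for n d r
  have reply_good: "good n d r (reply n d r)" if "\<exists>d'. good n d r d'" for n d r
    using someI_ex[OF that] that by (simp add: reply_def)
  have reply_move: "cops_move G d (reply n d r)" if "set d \<subseteq> pverts G" for n d r
  proof (cases "\<exists>d'. good n d r d'")
    case True
    then show ?thesis using reply_good[OF True] by (simp add: good_def)
  next
    case False
    then show ?thesis using that by (simp add: reply_def cops_move_refl)
  qed
  define upd where "upd = (\<lambda>(n, d) r. (n - 1 :: nat, reply (n - 1) d r))"
  define \<sigma> where "\<sigma> h = snd (foldl upd (t, c) h)" for h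
  have rounds: "fst (foldl upd (n, d) h) = n - length h" for n d h
    by (induction h arbitrary: n d) (auto simp: upd_def)
  have \<sigma>_snoc: "\<sigma> (h @ [r]) = reply (t - length h - 1) (\<sigma> h) r" for h r
    using rounds[of t c h] by (simp add: \<sigma>_def upd_def split_beta)
  have at_Suc: "cops_at \<sigma> r (Suc n) = reply (t - n - 1) (cops_at \<sigma> r n) (r n)" for r n
    by (simp add: cops_at_def \<sigma>_snoc)
  have pos: "length (cops_at \<sigma> r n) = k \<and> set (cops_at \<sigma> r n) \<subseteq> pverts G" for r n
  proof (induction n)
    case 0
    then show ?case using assms by (simp add: \<sigma>_def)
  next
    case (Suc n)
    then show ?case
      using reply_move[of "cops_at \<sigma> r n"] by (auto simp: at_Suc cops_move_def)
  qed
  have "cop_strategy G k \<sigma>"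
    unfolding cop_strategy_def
    using pos reply_move at_Suc by (metis cops_move_def)
  moreover have "\<exists>s\<le>t. captured_in_round \<sigma> r s" if play: "robber_play G r" for r
  proof -
    have "(\<exists>s\<le>n. captured_in_round \<sigma> r s) \<or> cops_win G (t - n) (cops_at \<sigma> r n) (r n)" if "n \<le> t" for n
      using that
    proof (induction n)
      case 0
      then show ?case using win play by (simp add: \<sigma>_def robber_play_def)
    next
      case (Suc n)
      have tn: "t - n = Suc (t - n - 1)" using Suc.prems by simp
      have next_r: "r (Suc n) \<in> pverts G" "legal_move G (r n) (r (Suc n))"
        using play by (auto simp: robber_play_def)
      show ?case
      proof (cases "(\<exists>s\<le>n. captured_in_round \<sigma> r s) \<or> r n \<in> set (cops_at \<sigma> r n)")
        case True
        then show ?thesis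
          by (meson captured_in_round_def le_SucI order_refl)
      next
        case False
        with Suc have "cops_win G (Suc (t - n - 1)) (cops_at \<sigma> r n) (r n)"
          using tn by auto
        with False have "\<exists>d'. good (t - n - 1) (cops_at \<sigma> r n) (r n) d'"
          by (auto simp: good_def)
        from reply_good[OF this]
        have "good (t - n - 1) (cops_at \<sigma> r n) (r n) (cops_at \<sigma> r (Suc n))"
          by (simp add: at_Suc)
        then have "r n \<in> set (cops_at \<sigma> r (Suc n))
            \<or> cops_win G (t - Suc n) (cops_at \<sigma> r (Suc n)) (r (Suc n))"
          using next_r by (auto simp: good_def)
        then show ?thesis
          by (auto simp: captured_in_round_def)
      qed
    qed
    from this[of t] show ?thesis
      by (auto simp: captured_in_round_def)
  qed
  ultimately show ?thesis
    by (auto simp: cops_capture_within_def)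
qed

text \<open>Where \<open>cops_win\<close> fails, the robber can answer every move of the cops so
  that it keeps failing. Collecting these answers against the given strategy yields a play without
  capture up to round \<open>t\<close>.\<close>

lemma cops_win_if_cops_capture_within:
  assumes "cops_capture_within G k t" "pverts G \<noteq> {}"
  shows "\<exists>c. length c = k \<and> set c \<subseteq> pverts G \<and> (\<forall>r \<in> pverts G. cops_win G t c r)"
proof -
  obtain \<sigma> where strategy: "cop_strategy G k \<sigma>"
    and capture: "\<And>r. robber_play G r \<Longrightarrow> \<exists>s\<le>t. captured_in_round \<sigma> r s"
    using assms(1) by (auto simp: cops_capture_within_def)
  have "cops_win G t (\<sigma> []) r0" if r0: "r0 \<in> pverts G" for r0
  proof (rule ccontr)
    assume lose: "\<not> cops_win G t (\<sigma> []) r0"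
    define esc where "esc n h r' \<longleftrightarrow> r' \<in> pverts G \<and> legal_move G (last h) r'
      \<and> \<not> cops_win G (t - Suc n) (\<sigma> h) r'" for n h r'
    define nxt where "nxt n h = (if \<exists>r'. esc n h r' then SOME r'. esc n h r' else last h)" for n h
    have nxt_esc: "esc n h (nxt n h)" if "\<exists>r'. esc n h r'" for n h
      using someI_ex[OF that] that by (simp add: nxt_def)
    have nxt_legal: "nxt n h \<in> pverts G \<and> legal_move G (last h) (nxt n h)" if "last h \<in> pverts G" for n h
    proof (cases "\<exists>r'. esc n h r'")
      case True
      then show ?thesis using nxt_esc[OF True] by (simp add: esc_def)
    next
      case False
      then show ?thesis using that by (simp add: nxt_def)
    qed
    \<comment> \<open>The strategy reads whole histories, so these are built first; the play
      \<open>r\<close> consists of their last entries.\<close>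
    define hist where "hist = rec_nat [r0] (\<lambda>n h. h @ [nxt n h])"
    define r where "r n = last (hist n)" for n
    have hist_0: "hist 0 = [r0]" and hist_Suc: "hist (Suc n) = hist n @ [nxt n (hist n)]" for n
      by (simp_all add: hist_def)
    have r_Suc: "r (Suc n) = nxt n (hist n)" for n
      by (simp add: r_def hist_Suc)
    have map_r: "map r [0..<Suc n] = hist n" for n
      by (induction n) (simp_all add: hist_0 hist_Suc r_def)
    have r_V: "r n \<in> pverts G" for n
    proof (induction n)
      case (Suc n)
      then show ?case
        using nxt_legal[of "hist n" n] unfolding r_Suc by (simp add: r_def)
    qed (simp add: r_def hist_0 r0)
    moreover have "legal_move G (r n) (r (Suc n))" for n
      using nxt_legal[of "hist n" n] r_V[of n] unfolding r_Suc by (simp add: r_def)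
    ultimately have play: "robber_play G r"
      by (simp add: robber_play_def)
    have at_Suc: "cops_at \<sigma> r (Suc n) = \<sigma> (hist n)" for n
      using map_r by (simp add: cops_at_def del: upt_Suc)
    have move: "cops_move G (cops_at \<sigma> r n) (cops_at \<sigma> r (Suc n))" for n
      using strategy play by (auto simp: cop_strategy_def cops_move_def)
    have "\<not> cops_win G (t - n) (cops_at \<sigma> r n) (r n) \<and> (\<forall>s\<le>n. \<not> captured_in_round \<sigma> r s)"
      if "n \<le> t" for n
      using that
    proof (induction n)
      case 0
      then show ?case
        using lose cops_win_captured[of r0 "\<sigma> []" G t] by (auto simp: r_def hist_0 captured_in_round_def)
    next
      case (Suc n)
      then have "\<not> cops_win G (Suc (t - Suc n)) (cops_at \<sigma> r n) (r n)"
        by (simp add: Suc_diff_Suc)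
      then have rn: "r n \<notin> set (cops_at \<sigma> r (Suc n))"
        and "\<exists>r'. esc n (hist n) r'"
        using move[of n] by (auto simp: at_Suc esc_def r_def)
      from nxt_esc[OF this(2)]
      have "\<not> cops_win G (t - Suc n) (cops_at \<sigma> r (Suc n)) (r (Suc n))"
        by (simp add: at_Suc r_Suc esc_def)
      then show ?case
        using Suc rn cops_win_captured[of "r (Suc n)"] by (auto simp: captured_in_round_def le_Suc_eq)
    qed
    then show False using capture[OF play] by blast
  qed
  moreover have "length (\<sigma> []) = k \<and> set (\<sigma> []) \<subseteq> pverts G"
  proof -
    \<comment> \<open>The strategy is constrained only along robber plays, so a constant play is
      used to inspect the initial placement.\<close>
    obtain v where "v \<in> pverts G" using assms(2) by blast
    then have "robber_play G (\<lambda>_. v)" by (simp add: robber_play_def)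
    then show ?thesis using strategy cops_at_0[of \<sigma> "\<lambda>_. v"] unfolding cop_strategy_def by metis
  qed
  ultimately show ?thesis by blast
qed

lemma cops_move_pair_iff:
  "cops_move G [A, B] c' \<longleftrightarrow> (\<exists>A' B'. c' = [A', B'] \<and> A' \<in> pverts G \<and> B' \<in> pverts G
     \<and> legal_move G A A' \<and> legal_move G B B')"
  by (auto simp: cops_move_def length_Suc_conv less_Suc_eq)

section \<open>Evading two cops from a corner\<close>

text \<open>
  The robber confines herself to \<open>P\<close>, the product of two diametral paths; \<open>b\<close> is the distance from a
  corner of this grid, and \<open>D\<close> is the distance of the opposite corner.
\<close>

locale cornered_grid = wf: pair_wf_digraph G
  for G :: "'a pair_pre_digraph" +
  fixes P :: "'a set" and b :: "'a \<Rightarrow> nat" and D :: nat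
  assumes P_verts: "P \<subseteq> pverts G"
    and height_edge: "(x, y) \<in> parcs G \<Longrightarrow> b y = Suc (b x) \<or> b x = Suc (b y)"
    and height_le: "x \<in> pverts G \<Longrightarrow> b x \<le> D"
    and ascend: "x \<in> P \<Longrightarrow> b x < D \<Longrightarrow> \<exists>y \<in> P. (x, y) \<in> parcs G \<and> b y = Suc (b x)"
    and descend: "x \<in> P \<Longrightarrow> 0 < b x \<Longrightarrow> \<exists>y \<in> P. (x, y) \<in> parcs G \<and> b x = Suc (b y)"
    and two_exits: "x \<in> P \<Longrightarrow> b x = 0 \<Longrightarrow> \<exists>y \<in> P. (x, y) \<in> parcs G \<and> b y = 1 \<and> y \<noteq> a"
begin

text \<open>
  The robber at \<open>r\<close> is to move and survives \<open>T\<close> rounds: either both cops are farther from the corner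
  than she is, and she retreats into the corner; or \<open>A\<close> has driven her out of it and she runs
  towards \<open>B\<close>, meeting it halfway; or she has left the corner through one exit while \<open>A\<close> occupies
  the other, and she waits for \<open>A\<close> to commit itself.
\<close>

definition evading :: "nat \<Rightarrow> 'a \<Rightarrow> 'a \<Rightarrow> 'a \<Rightarrow> bool" where
  "evading T A B r \<longleftrightarrow> b r < b A \<and> b r < b B \<and> 2 * T \<le> b A + b B
     \<or> b A < b r \<and> b r + 2 * T \<le> Suc (b B)
     \<or> b r = 1 \<and> b A = 1 \<and> A \<noteq> r \<and> 2 * T \<le> b B"

lemma height_legal_move:
  "legal_move G x y \<Longrightarrow> x = y \<or> b y = Suc (b x) \<or> b x = Suc (b y)"
  using height_edge by (auto simp: legal_move_def)

text \<open>Each arc changes the height by exactly one, so a round costs at most the two units by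
  which \<open>2 * T\<close> drops. For \<open>T = 0\<close> only the robber's own move has to be
  safe, hence the guard \<open>0 < T\<close>.\<close>

lemma evading_step:
  assumes r: "r \<in> P" and V: "A \<in> pverts G" "B \<in> pverts G"
    and ev: "evading (Suc T) A B r"
  shows "\<exists>r' \<in> P. legal_move G r r' \<and> r' \<noteq> A \<and> r' \<noteq> B \<and>
    (0 < T \<longrightarrow> (\<forall>A' B'. legal_move G A A' \<longrightarrow> legal_move G B B' \<longrightarrow>
      evading T A' B' r' \<or> evading T B' A' r'))"
proof (cases "T = 0")
  case True
  with ev have "r \<noteq> A" "r \<noteq> B" by (auto simp: evading_def)
  with True r show ?thesis by (intro bexI[of _ r]) auto
next
  case False
  then have T: "0 < T" by simp
  have robber_to: ?thesis
    if "r' \<in> P" "legal_move G r r'" "r' \<noteq> A" "r' \<noteq> B"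
      and "\<And>A' B'. legal_move G A A' \<Longrightarrow> legal_move G B B' \<Longrightarrow> evading T A' B' r' \<or> evading T B' A' r'"
    for r'
    using that by blast
  note robber_stays = robber_to[OF r legal_move_refl]
  consider (free) "b r < b A" "b r < b B" "2 * Suc T \<le> b A + b B"
    | (chase) "b A < b r" "b r + 2 * Suc T \<le> Suc (b B)"
    | (diagonal) "b r = 1" "b A = 1" "A \<noteq> r" "2 * Suc T \<le> b B"
    using ev unfolding evading_def by blast
  then show ?thesis
  proof cases
    case free
    show ?thesis
    proof (cases "b r = 0")
      case False
      then obtain r' where r': "r' \<in> P" "(r, r') \<in> parcs G" "b r = Suc (b r')"
        using descend r by auto
      show ?thesis
      proof (rule robber_to[OF r'(1)])
        fix A' B' assume "legal_move G A A'" "legal_move G B B'"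
        from this[THEN height_legal_move] show "evading T A' B' r' \<or> evading T B' A' r'"
          using free r'(3) unfolding evading_def by (intro disjI1) auto
      qed (use free r' in \<open>auto simp: legal_move_def\<close>)
    next
      case r0: True
      \<comment> \<open>A cop at height 1 threatens the corner, so the robber takes an exit other
        than \<open>X\<close>. The reply of \<open>X\<close> decides the phase: height 0 starts the
        chase, height 2 frees the robber, and staying gives the diagonal position.\<close>
      have exit: ?thesis if X: "b X = 1" "2 * T < b Y" "(X, Y) = (A, B) \<or> (X, Y) = (B, A)" for X Y
      proof -
        obtain r' where r': "r' \<in> P" "(r, r') \<in> parcs G" "b r' = 1" "r' \<noteq> X"
          using two_exits[OF r r0] by blast
        have "evading T X' Y' r'" if m: "legal_move G X X'" "legal_move G Y Y'" for X' Y'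
          using height_legal_move[OF m(1)] height_legal_move[OF m(2)] X(1,2) r'(3,4) T
          unfolding evading_def by auto
        moreover have "r' \<noteq> Y" using X(1,2) r'(3) T by auto
        moreover have "legal_move G r r'" using r'(2) by (simp add: legal_move_def)
        ultimately show ?thesis using robber_to[OF r'(1)] r'(4) X(3) by blast
      qed
      show ?thesis
      proof (cases "b A = 1 \<or> b B = 1")
        case True
        then show ?thesis using exit[of A B] exit[of B A] free by fastforce
      next
        case False
        show ?thesis
        proof (rule robber_stays)
          fix A' B' assume "legal_move G A A'" "legal_move G B B'"
          from this[THEN height_legal_move] show "evading T A' B' r \<or> evading T B' A' r"
            using free False r0 unfolding evading_def by (intro disjI1) auto
        qed (use free in auto)
      qed
    qed
  next
    case chase
    \<comment> \<open>The robber rises by one, so \<open>A\<close> cannot catch up in height, while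
      the gap to \<open>B\<close> shrinks by at most two.\<close>
    then have "b r < D" using T height_le[OF V(2)] by simp
    then obtain r' where r': "r' \<in> P" "(r, r') \<in> parcs G" "b r' = Suc (b r)"
      using ascend r by blast
    have "b A < b r'" "b r' < b B" using chase r'(3) T by simp_all
    then have ne: "r' \<noteq> A" "r' \<noteq> B" by blast+
    have "legal_move G r r'" using r'(2) by (simp add: legal_move_def)
    then show ?thesis
    proof (rule robber_to[OF r'(1) _ ne])
      fix A' B' assume "legal_move G A A'" "legal_move G B B'"
      from this[THEN height_legal_move] have "b A' < b r' \<and> b r' + 2 * T \<le> Suc (b B')"
        using chase r'(3) by auto
      then show "evading T A' B' r' \<or> evading T B' A' r'" by (simp add: evading_def)
    qed
  next
    case diagonal
    show ?thesis
    \<comment> \<open>The robber waits: \<open>A\<close> either stays or goes to height 0 or 2, and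
      each choice leads back to one of the three phases.\<close>
    proof (rule robber_stays)
      fix A' B' assume m: "legal_move G A A'" "legal_move G B B'"
      have "2 * T < b B'" using height_legal_move[OF m(2)] diagonal(4) by auto
      moreover have "b A' = 0 \<or> b A' = 2 \<or> A' = A"
        using height_legal_move[OF m(1)] diagonal(2) by auto
      ultimately show "evading T A' B' r \<or> evading T B' A' r"
        using diagonal T by (auto simp: evading_def)
    qed (use diagonal in auto)
  qed
qed

text \<open>The disjunction lets the cops exchange their roles. With a positive count,
  \<open>evading\<close> keeps the robber off both cops, so their move does not capture her.\<close>

lemma evading_robber_survives:
  assumes "r \<in> P" "A \<in> pverts G" "B \<in> pverts G"
    and "evading (Suc T) A B r \<or> evading (Suc T) B A r"
  shows "\<exists>r' \<in> P. legal_move G r r' \<and> \<not> cops_win G T [A, B] r'"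
  using assms
proof (induction T arbitrary: A B r)
  case 0
  then show ?case
    using evading_step[of r A B 0] evading_step[of r B A 0] by auto
next
  case (Suc T)
  obtain r' where r': "r' \<in> P" "legal_move G r r'" "r' \<noteq> A" "r' \<noteq> B"
    and ev: "\<And>A' B'. legal_move G A A' \<Longrightarrow> legal_move G B B' \<Longrightarrow>
      evading (Suc T) A' B' r' \<or> evading (Suc T) B' A' r'"
    using Suc.prems evading_step[of r A B "Suc T"] evading_step[of r B A "Suc T"]
    by (metis zero_less_Suc)
  have "\<not> cops_win G (Suc T) [A, B] r'"
  proof
    assume "cops_win G (Suc T) [A, B] r'"
    then obtain A' B' where m: "A' \<in> pverts G" "B' \<in> pverts G" "legal_move G A A'" "legal_move G B B'"
      and win: "r' = A' \<or> r' = B' \<or> (\<forall>r'' \<in> pverts G. legal_move G r' r'' \<longrightarrow> cops_win G T [A', B'] r'')"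
      using r' by (auto simp: cops_move_pair_iff)
    have "r' \<noteq> A'" "r' \<noteq> B'" using ev[OF m(3,4)] by (auto simp: evading_def)
    then show False using win Suc.IH[OF r'(1) m(1,2) ev[OF m(3,4)]] P_verts by blast
  qed
  then show ?case using r' by blast
qed

lemma robber_survives_from_corner:
  assumes "z \<in> P" "b z = 0" "A \<in> pverts G" "B \<in> pverts G" "0 < b A" "0 < b B"
    and "2 * Suc T \<le> b A + b B"
  shows "\<exists>r \<in> pverts G. \<not> cops_win G T [A, B] r"
  using evading_robber_survives[of z A B T] assms P_verts by (auto simp: evading_def)

end

section \<open>Chasing with two cops\<close>

definition static_edge :: "'a set \<Rightarrow> ('a \<Rightarrow> 'a \<Rightarrow> nat) \<Rightarrow> 'a \<Rightarrow> 'a \<Rightarrow> bool" where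
  "static_edge V d x y \<longleftrightarrow> (\<forall>z \<in> V. d z y = d z x)"

text \<open>An arc of the product moves in one factor, whose distance \<open>d\<close> is pulled
  back to the product. Collected here are the conclusions of \<open>graph_dist_edge_cases\<close>
  and \<open>geodesic_extend\<close>; \<open>0 < d z x\<close> says that \<open>z\<close> and
  \<open>x\<close> differ in that factor.\<close>

definition tree_edge :: "'a set \<Rightarrow> ('a \<Rightarrow> 'a \<Rightarrow> nat) \<Rightarrow> 'a \<Rightarrow> 'a \<Rightarrow> bool" where
  "tree_edge V d x y \<longleftrightarrow> (\<forall>z \<in> V. (d z y = Suc (d z x) \<or> d z x = Suc (d z y)) \<and>
     (\<forall>s \<in> V. d s x = d s z + d z x \<longrightarrow> 0 < d z x \<longrightarrow> d s y = d s z + d z y))"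

lemma static_edgeD: "static_edge V d x y \<Longrightarrow> z \<in> V \<Longrightarrow> d z y = d z x"
  by (simp add: static_edge_def)

lemma tree_edge_cases: "tree_edge V d x y \<Longrightarrow> z \<in> V \<Longrightarrow> d z y = Suc (d z x) \<or> d z x = Suc (d z y)"
  by (simp add: tree_edge_def)

lemma tree_edge_geodesic:
  "tree_edge V d x y \<Longrightarrow> z \<in> V \<Longrightarrow> s \<in> V \<Longrightarrow> d s x = d s z + d z x \<Longrightarrow> 0 < d z x \<Longrightarrow>
    d s y = d s z + d z y"
  by (simp add: tree_edge_def)

text \<open>Working with two pseudometrics that jointly separate vertices, instead of with pairs,
  allows the factors to be interchanged by an interpretation.\<close>

locale tree_product = wf: pair_wf_digraph G
  for G :: "'a pair_pre_digraph" +
  fixes d1 d2 :: "'a \<Rightarrow> 'a \<Rightarrow> nat"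
  assumes refl1 [simp]: "x \<in> pverts G \<Longrightarrow> d1 x x = 0"
    and refl2 [simp]: "x \<in> pverts G \<Longrightarrow> d2 x x = 0"
    and eq_if_zero: "x \<in> pverts G \<Longrightarrow> y \<in> pverts G \<Longrightarrow> d1 x y = 0 \<Longrightarrow> d2 x y = 0 \<Longrightarrow> x = y"
    and sym1: "x \<in> pverts G \<Longrightarrow> y \<in> pverts G \<Longrightarrow> d1 x y = d1 y x"
    and sym2: "x \<in> pverts G \<Longrightarrow> y \<in> pverts G \<Longrightarrow> d2 x y = d2 y x"
    and tri1: "x \<in> pverts G \<Longrightarrow> y \<in> pverts G \<Longrightarrow> z \<in> pverts G \<Longrightarrow> d1 x z \<le> d1 x y + d1 y z"
    and tri2: "x \<in> pverts G \<Longrightarrow> y \<in> pverts G \<Longrightarrow> z \<in> pverts G \<Longrightarrow> d2 x z \<le> d2 x y + d2 y z"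
    and step1: "x \<in> pverts G \<Longrightarrow> y \<in> pverts G \<Longrightarrow> 0 < d1 x y \<Longrightarrow>
      \<exists>w. (x, w) \<in> parcs G \<and> d1 x y = Suc (d1 w y) \<and> static_edge (pverts G) d2 x w"
    and step2: "x \<in> pverts G \<Longrightarrow> y \<in> pverts G \<Longrightarrow> 0 < d2 x y \<Longrightarrow>
      \<exists>w. (x, w) \<in> parcs G \<and> d2 x y = Suc (d2 w y) \<and> static_edge (pverts G) d1 x w"
    and edge: "(x, y) \<in> parcs G \<Longrightarrow>
      tree_edge (pverts G) d1 x y \<and> static_edge (pverts G) d2 x y \<or>
      tree_edge (pverts G) d2 x y \<and> static_edge (pverts G) d1 x y"

lemma (in tree_product) tree_product_commute: "tree_product G d2 d1"
  by unfold_locales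
    (fact refl1 refl2 sym1 sym2 tri1 tri2 step1 step2 | assumption | erule (2) eq_if_zero
      | (rule disj_commute[THEN iffD1], erule edge))+

context tree_product
begin

abbreviation dist :: "'a \<Rightarrow> 'a \<Rightarrow> nat" where
  "dist x y \<equiv> d1 x y + d2 x y"

text \<open>
  A cop that started at \<open>s\<close>, has moved away from \<open>s\<close> in each of \<open>k\<close> rounds and is now at \<open>a\<close>, on a
  geodesic from \<open>s\<close> to the robber at \<open>r\<close>. The cop first moves in the first factor only, until the two
  coordinate distances to the robber balance; from then on the cop keeps them balanced, up to the
  tolerance \<open>j\<close>, which is 2 before and 1 after the move of the cop.
\<close>

definition chasing :: "nat \<Rightarrow> nat \<Rightarrow> 'a \<Rightarrow> 'a \<Rightarrow> 'a \<Rightarrow> bool" where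
  "chasing j k s a r \<longleftrightarrow> d1 s r = d1 s a + d1 a r \<and> d2 s r = d2 s a + d2 a r \<and> dist s a = k \<and>
     d2 a r \<le> d1 a r + j \<and> (d2 s a = 0 \<or> d1 a r \<le> d2 a r + j)"

lemma dist_sym: "x \<in> pverts G \<Longrightarrow> y \<in> pverts G \<Longrightarrow> dist x y = dist y x"
  using sym1 sym2 by simp

lemma dist_eq_0: "x \<in> pverts G \<Longrightarrow> y \<in> pverts G \<Longrightarrow> dist x y = 0 \<Longrightarrow> x = y"
  using eq_if_zero by simp

lemma dist_neq_0: "x \<in> pverts G \<Longrightarrow> y \<in> pverts G \<Longrightarrow> x \<noteq> y \<Longrightarrow> dist x y \<noteq> 0"
  using dist_eq_0 by metis

lemma edge_cases:
  assumes "(x, y) \<in> parcs G" "z \<in> pverts G"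
  shows "(d1 z y = Suc (d1 z x) \<or> d1 z x = Suc (d1 z y)) \<and> d2 z y = d2 z x \<or>
    (d2 z y = Suc (d2 z x) \<or> d2 z x = Suc (d2 z y)) \<and> d1 z y = d1 z x"
  using edge[OF assms(1)]
proof (elim disjE conjE)
  assume e: "tree_edge (pverts G) d1 x y" "static_edge (pverts G) d2 x y"
  show ?thesis using tree_edge_cases[OF e(1) assms(2)] static_edgeD[OF e(2) assms(2)] by simp
next
  assume e: "tree_edge (pverts G) d2 x y" "static_edge (pverts G) d1 x y"
  show ?thesis using tree_edge_cases[OF e(1) assms(2)] static_edgeD[OF e(2) assms(2)] by simp
qed

lemma dist_edge:
  assumes "(x, y) \<in> parcs G" "z \<in> pverts G"
  shows "dist z y = Suc (dist z x) \<or> dist z x = Suc (dist z y)"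
  using edge_cases[OF assms] by auto

lemma dist_edge_parity:
  assumes "(x, y) \<in> parcs G" "z \<in> pverts G"
  shows "even (dist z y) \<longleftrightarrow> odd (dist z x)"
  using dist_edge[OF assms] by presburger

text \<open>A step in the factor where the robber is farther away lowers the tolerance from 2 to 1.
  It follows a geodesic in that factor, so it also leads away from \<open>s\<close>.\<close>

lemma chase_move:
  assumes "s \<in> pverts G" "a \<in> pverts G" "r \<in> pverts G" "a \<noteq> r" "chasing 2 k s a r"
  shows "\<exists>a'. (a, a') \<in> parcs G \<and> chasing 1 (Suc k) s a' r \<and> dist a r = Suc (dist a' r)"
proof (cases "d2 a r \<le> d1 a r")
  case True
  then have "0 < d1 a r" using eq_if_zero[of a r] assms by fastforce
  then obtain w where w: "(a, w) \<in> parcs G" "d1 a r = Suc (d1 w r)" "static_edge (pverts G) d2 a w"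
    using step1 assms by blast
  then have wV: "w \<in> pverts G" using wf.in_arcsD2 by blast
  have d2w: "d2 s w = d2 s a" "d2 w r = d2 a r"
    using static_edgeD[OF w(3)] assms(1,3) sym2[OF assms(2,3)] sym2[OF wV assms(3)] by simp_all
  then have "dist s w \<le> Suc (dist s a)" using dist_edge[OF w(1) assms(1)] by linarith
  then have "d1 s w = Suc (d1 s a)"
    using tri1[of s w r] assms wV w(2) d2w by (simp add: chasing_def)
  then show ?thesis
    using w True d2w assms(5) by (intro exI[of _ w]) (auto simp: chasing_def)
next
  case False
  then have "0 < d2 a r" by simp
  then obtain w where w: "(a, w) \<in> parcs G" "d2 a r = Suc (d2 w r)" "static_edge (pverts G) d1 a w"
    using step2 assms by blast
  then have wV: "w \<in> pverts G" using wf.in_arcsD2 by blast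
  have d1w: "d1 s w = d1 s a" "d1 w r = d1 a r"
    using static_edgeD[OF w(3)] assms(1,3) sym1[OF assms(2,3)] sym1[OF wV assms(3)] by simp_all
  then have "dist s w \<le> Suc (dist s a)" using dist_edge[OF w(1) assms(1)] by linarith
  then have "d2 s w = Suc (d2 s a)"
    using tri2[of s w r] assms wV w(2) d1w by (simp add: chasing_def)
  then show ?thesis
    using w False d1w assms(5) by (intro exI[of _ w]) (auto simp: chasing_def)
qed

text \<open>Only a robber sharing the moving coordinate with the cop could break the geodesic.
  Balance within 1 and distance at least 2 exclude this, except in the second factor while the cop
  still has its starting coordinate, where the geodesic condition is trivial.\<close>

lemma chase_robber_move:
  assumes V: "s \<in> pverts G" "a \<in> pverts G" and r: "(r, r') \<in> parcs G"
    and ch: "chasing 1 k s a r" and far: "2 \<le> dist a r"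
  shows "chasing 2 k s a r'"
proof -
  have r'V: "r' \<in> pverts G" using wf.in_arcsD2 r by blast
  consider (first) "tree_edge (pverts G) d1 r r'" "static_edge (pverts G) d2 r r'"
    | (second) "tree_edge (pverts G) d2 r r'" "static_edge (pverts G) d1 r r'"
    using edge[OF r] by blast
  then show ?thesis
  proof cases
    case first
    have "0 < d1 a r" using ch far by (auto simp: chasing_def)
    then have "d1 s r' = d1 s a + d1 a r'"
      using tree_edge_geodesic[OF first(1) V(2,1)] ch by (simp add: chasing_def)
    moreover have "d1 a r' = Suc (d1 a r) \<or> d1 a r = Suc (d1 a r')"
      by (rule tree_edge_cases[OF first(1) V(2)])
    ultimately show ?thesis
      using static_edgeD[OF first(2) V(1)] static_edgeD[OF first(2) V(2)] ch
      unfolding chasing_def by linarith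
  next
    case second
    have "d2 s r' = d2 s a + d2 a r'"
    proof (cases "d2 a r = 0")
      case True
      then have "d2 s a = 0" using ch far by (auto simp: chasing_def)
      then show ?thesis
        using tri2[of s a r'] tri2[of a s r'] sym2[of a s] V r'V by simp
    next
      case False
      then show ?thesis
        using tree_edge_geodesic[OF second(1) V(2,1)] ch by (simp add: chasing_def)
    qed
    moreover have "d2 a r' = Suc (d2 a r) \<or> d2 a r = Suc (d2 a r')"
      by (rule tree_edge_cases[OF second(1) V(2)])
    ultimately show ?thesis
      using static_edgeD[OF second(2) V(1)] static_edgeD[OF second(2) V(2)] ch
      unfolding chasing_def by linarith
  qed
qed

lemma chasing_tolerance: "chasing 1 k s a r \<Longrightarrow> chasing 2 k s a r"
  by (auto simp: chasing_def)

lemma step: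
  assumes "y \<in> pverts G" "r \<in> pverts G" "dist y r \<noteq> 0"
  shows "\<exists>w. (y, w) \<in> parcs G \<and> dist y r = Suc (dist w r)"
proof (cases "d1 y r = 0")
  case False
  then obtain w where w: "(y, w) \<in> parcs G" "d1 y r = Suc (d1 w r)" "static_edge (pverts G) d2 y w"
    using step1 assms by blast
  then have "d2 y r = d2 w r"
    using static_edgeD[OF w(3) assms(2)] sym2[OF assms(1,2)] sym2[OF wf.in_arcsD2[OF w(1)] assms(2)]
    by simp
  then show ?thesis using w by auto
next
  case True
  then obtain w where w: "(y, w) \<in> parcs G" "d2 y r = Suc (d2 w r)" "static_edge (pverts G) d1 y w"
    using step2 assms by auto
  then have "d1 y r = d1 w r"
    using static_edgeD[OF w(3) assms(2)] sym1[OF assms(1,2)] sym1[OF wf.in_arcsD2[OF w(1)] assms(2)]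
    by simp
  then show ?thesis using w by auto
qed

lemma approach:
  assumes "y \<in> pverts G" "r \<in> pverts G" "dist y r \<le> 2"
  shows "\<exists>y'. y' \<in> pverts G \<and> legal_move G y y' \<and> dist y' r \<le> 1"
proof (cases "dist y r = 0")
  case True
  then show ?thesis using assms by (intro exI[of _ y]) simp
next
  case False
  then obtain w where "(y, w) \<in> parcs G" "dist y r = Suc (dist w r)"
    using step assms by blast
  then show ?thesis
    using wf.in_arcsD2 assms(3) by (intro exI[of _ w]) (auto simp: legal_move_def)
qed

text \<open>
  The cop \<open>x\<close> will be at even distance from the robber after the next move. As long as the robber moves,
  this cop alone suffices; a pass of the robber swaps the roles of the two cops, unless the other cop
  has come within distance 1 and punishes it.
\<close>

lemma two_cops_win:
  assumes V: "sx \<in> pverts G" "x \<in> pverts G" "sy \<in> pverts G" "y \<in> pverts G" "r \<in> pverts G"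
    and ecc: "\<And>v. v \<in> pverts G \<Longrightarrow> dist sx v \<le> Suc m" "\<And>v. v \<in> pverts G \<Longrightarrow> dist sy v \<le> Suc m"
    and c: "c = [x, y] \<or> c = [y, x]"
    and k: "k + Suc n = m"
    and x: "chasing 2 k sx x r" "odd (dist x r)"
    and y: "chasing 2 k sy y r \<and> even (dist y r) \<or> dist y r \<le> 2"
  shows "cops_win G (Suc n) c r"
  using assms
proof (induction n arbitrary: sx x sy y r c k rule: less_induct)
  case (less n sx x sy y r c k)
  note V = less.prems(1-5) and ecc = less.prems(6,7) and c = less.prems(8) and k = less.prems(9)
    and x = less.prems(10,11) and y = less.prems(12)
  show ?case
  proof (cases "r \<in> set c")
    case True
    then show ?thesis by simp
  next
    case False
    then have ne: "x \<noteq> r" "y \<noteq> r" using c by auto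
    obtain x' where x': "(x, x') \<in> parcs G" "chasing 1 (Suc k) sx x' r" "dist x r = Suc (dist x' r)"
      using chase_move[OF V(1,2,5) ne(1) x(1)] by blast
    obtain y' where y': "y' \<in> pverts G" "legal_move G y y'"
      "chasing 1 (Suc k) sy y' r \<and> odd (dist y' r) \<or> dist y' r \<le> 1"
    \<comment> \<open>Within distance 2 the second cop gives up its geodesic and merely stays near,
      ready to capture a passing robber; otherwise it chases like \<open>x\<close>.\<close>
    proof (cases "dist y r \<le> 2")
      case True
      then show ?thesis using approach[OF V(4,5)] that by blast
    next
      case False
      then obtain w where "(y, w) \<in> parcs G" "chasing 1 (Suc k) sy w r" "dist y r = Suc (dist w r)"
        using chase_move[OF V(3,4,5) ne(2)] y by blast
      then show ?thesis using that[of w] y False wf.in_arcsD2 by (auto simp: legal_move_def)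
    qed
    have x'V: "x' \<in> pverts G" and x'_even: "even (dist x' r)"
      using x' x(2) wf.in_arcsD2 by auto
    \<comment> \<open>The list keeps the order of the cops, although \<open>x\<close> and
      \<open>y\<close> name roles that may be exchanged.\<close>
    define c' where "c' = (if c = [x, y] then [x', y'] else [y', x'])"
    have c': "c' = [x', y'] \<or> c' = [y', x']" and move: "cops_move G c c'"
      using c x'(1) x'V y'(1,2) by (auto simp: c'_def cops_move_pair_iff legal_move_def)
    show ?thesis
    proof (cases "r \<in> set c'")
      case True
      then show ?thesis using move by auto
    next
      case False
      then have ne': "x' \<noteq> r" "y' \<noteq> r" using c' by auto
      have "dist x' r \<noteq> 0" by (rule dist_neq_0[OF x'V V(5) ne'(1)])
      with x'_even have x'_far: "2 \<le> dist x' r" by presburger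
      \<comment> \<open>A robber still free after this move is at distance at least
        \<open>k + 3\<close> from \<open>sx\<close>. For \<open>n = 0\<close> this would be
        \<open>m + 2\<close>, beyond the bound \<open>ecc\<close>, so the last round
        captures.\<close>
      have "dist sx r = Suc k + dist x' r" using x'(2) by (simp add: chasing_def)
      then have "n \<noteq> 0" using ecc(1)[OF V(5)] x'_far k by auto
      then obtain n' where n': "n = Suc n'" using not0_implies_Suc by blast
      then have n'_less: "n' < n" by simp
      have y'_pos: "dist y' r \<noteq> 0" by (rule dist_neq_0[OF y'(1) V(5) ne'(2)])
      have "cops_win G n c' r'" if r': "r' \<in> pverts G" "legal_move G r r'" for r'
      proof (cases "r' = r")
        case True
        show ?thesis
        proof (cases "dist y' r \<le> 1")
          case True
          obtain w where w: "(y', w) \<in> parcs G" "dist y' r = Suc (dist w r)"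
            using step[OF y'(1) V(5) y'_pos] by blast
          then have "w \<in> pverts G" "dist w r = 0" using wf.in_arcsD2 True by auto
          then have "legal_move G y' r"
            using w(1) V(5) dist_eq_0[of w r] by (auto simp: legal_move_def)
          then have "cops_move G c' (if c' = [x', y'] then [x', r] else [r, x'])"
            using c' x'V V(5) by (auto simp: cops_move_pair_iff)
          then show ?thesis
            unfolding n' \<open>r' = r\<close> by (auto split: if_splits)
        next
          case False
          \<comment> \<open>The pass leaves \<open>y'\<close> at odd distance before its next move,
            so it takes the lead and \<open>x'\<close> becomes the second cop.\<close>
          then have "chasing 2 (Suc k) sy y' r" "odd (dist y' r)"
            using y'(3) chasing_tolerance by auto
          moreover have "chasing 2 (Suc k) sx x' r \<and> even (dist x' r) \<or> dist x' r \<le> 2"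
            using x'(2) x'_even chasing_tolerance by blast
          ultimately show ?thesis
            using less.IH[OF n'_less V(3) y'(1) V(1) x'V V(5) ecc(2,1), of c' "Suc k"] c' k n' \<open>r' = r\<close> by auto
        qed
      next
        case False
        then have arc: "(r, r') \<in> parcs G" using r'(2) by (auto simp: legal_move_def)
        have "chasing 2 (Suc k) sx x' r'"
          by (rule chase_robber_move[OF V(1) x'V arc x'(2) x'_far])
        moreover have "odd (dist x' r')"
          using dist_edge_parity[OF arc x'V] x'_even by blast
        moreover have "chasing 2 (Suc k) sy y' r' \<and> even (dist y' r') \<or> dist y' r' \<le> 2"
        proof (cases "dist y' r \<le> 1")
          case True
          then show ?thesis using dist_edge[OF arc y'(1)] by auto
        next
          case False
          then show ?thesis
            using chase_robber_move[OF V(3) y'(1) arc] dist_edge_parity[OF arc y'(1)] y'(3)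
            by (metis Suc_1 not_less_eq_eq)
        qed
        ultimately show ?thesis
          using less.IH[OF n'_less V(1) x'V V(3) y'(1) r'(1) ecc, of c' "Suc k"] c' k n' by auto
      qed
      then show ?thesis using move by auto
    qed
  qed
qed

lemma adjacent_cops_win_ordered:
  assumes AB: "(A, B) \<in> parcs G" and r: "r \<in> pverts G" and "0 < m"
    and ecc: "\<And>v. v \<in> pverts G \<Longrightarrow> dist A v \<le> Suc m" "\<And>v. v \<in> pverts G \<Longrightarrow> dist B v \<le> Suc m"
    and ordered: "d2 A r \<le> Suc (d1 A r)"
  shows "cops_win G m [A, B] r"
proof -
  have V: "A \<in> pverts G" "B \<in> pverts G" using AB wf.in_arcsD1 wf.in_arcsD2 by auto
  obtain n where n: "0 + Suc n = m" using \<open>0 < m\<close> gr0_implies_Suc by auto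
  note syms = sym1[OF V(1) r] sym1[OF V(2) r] sym2[OF V(1) r] sym2[OF V(2) r]
  \<comment> \<open>The arc from \<open>A\<close> to \<open>B\<close> changes one coordinate
    distance by one, which uses up the second unit of the tolerance 2. Both cops are still on their
    starts, so the rest of \<open>chasing\<close> is trivial.\<close>
  have "d2 B r \<le> d1 B r + 2"
    using edge_cases[OF AB r] ordered syms by auto
  then have chA: "chasing 2 0 A A r" and chB: "chasing 2 0 B B r"
    using ordered V by (simp_all add: chasing_def)
  \<comment> \<open>Adjacent starts have opposite parities, so exactly one cop is at odd distance
    and takes the lead.\<close>
  have parity: "even (dist B r) \<longleftrightarrow> odd (dist A r)"
    using dist_edge_parity[OF AB r] dist_sym[OF V(1) r] dist_sym[OF V(2) r] by simp
  have "cops_win G (Suc n) [A, B] r"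
  proof (cases "odd (dist A r)")
    case True
    then show ?thesis
      using two_cops_win[OF V(1,1) V(2,2) r ecc _ n chA] parity chB by blast
  next
    case False
    then show ?thesis
      using two_cops_win[OF V(2,2) V(1,1) r ecc(2,1) _ n chB] parity chA by blast
  qed
  then show ?thesis using n by (simp del: cops_win.simps)
qed

text \<open>The chase begins in the first factor, so the factors are interchanged if the second
  coordinate distance exceeds the first by more than one.\<close>

lemma adjacent_cops_win:
  assumes AB: "(A, B) \<in> parcs G" and r: "r \<in> pverts G" and "0 < m"
    and ecc: "\<And>v. v \<in> pverts G \<Longrightarrow> d1 A v + d2 A v \<le> Suc m" "\<And>v. v \<in> pverts G \<Longrightarrow> d1 B v + d2 B v \<le> Suc m"
  shows "cops_win G m [A, B] r"
proof -
  interpret swapped: tree_product G d2 d1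
    by (rule tree_product_commute)
  show ?thesis
  proof (cases "d2 A r \<le> Suc (d1 A r)")
    case True
    then show ?thesis using adjacent_cops_win_ordered assms by blast
  next
    case False
    then show ?thesis
      using swapped.adjacent_cops_win_ordered[OF AB r \<open>0 < m\<close>] ecc by (simp add: add.commute)
  qed
qed

end

section \<open>Products of two trees\<close>

lemma pverts_cart_prod [simp]: "pverts (G \<box> H) = pverts G \<times> pverts H"
  by (simp add: cart_prod_def)

lemma parcs_cart_prod_iff:
  "(x, y) \<in> parcs (G \<box> H) \<longleftrightarrow>
    fst x \<in> pverts G \<and> fst x = fst y \<and> (snd x, snd y) \<in> parcs H \<or>
    snd x \<in> pverts H \<and> snd x = snd y \<and> (fst x, fst y) \<in> parcs G"
  by (cases x; cases y) (simp add: cart_prod_def)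

lemma (in tree_graph) tree_edge_pullback:
  assumes e: "(f x, f y) \<in> parcs G" and V: "f ` V \<subseteq> pverts G"
  shows "tree_edge V (\<lambda>u v. graph_dist G (f u) (f v)) x y"
  unfolding tree_edge_def
proof (intro ballI conjI impI)
  fix z assume z: "z \<in> V"
  then have zV: "f z \<in> pverts G" using V by auto
  then show "graph_dist G (f z) (f y) = Suc (graph_dist G (f z) (f x)) \<or>
      graph_dist G (f z) (f x) = Suc (graph_dist G (f z) (f y))"
    by (rule graph_dist_edge_cases[OF e])
  fix s assume s: "s \<in> V"
    and geo: "graph_dist G (f s) (f x) = graph_dist G (f s) (f z) + graph_dist G (f z) (f x)"
    and "0 < graph_dist G (f z) (f x)"
  then have "f z \<noteq> f x" using in_arcsD1[OF e] by auto
  moreover have "f s \<in> pverts G" using s V by auto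
  ultimately show "graph_dist G (f s) (f y) = graph_dist G (f s) (f z) + graph_dist G (f z) (f y)"
    using geodesic_extend[OF _ zV e _ geo] by blast
qed

locale two_trees = T1: tree_graph T1 + T2: tree_graph T2
  for T1 :: "'a pair_pre_digraph" and T2 :: "'b pair_pre_digraph"
begin

definition D1 :: "'a \<times> 'b \<Rightarrow> 'a \<times> 'b \<Rightarrow> nat" where
  "D1 = (\<lambda>x y. graph_dist T1 (fst x) (fst y))"

definition D2 :: "'a \<times> 'b \<Rightarrow> 'a \<times> 'b \<Rightarrow> nat" where
  "D2 = (\<lambda>x y. graph_dist T2 (snd x) (snd y))"

sublocale prod: pair_wf_digraph "T1 \<box> T2"
proof
  fix e assume e: "e \<in> parcs (T1 \<box> T2)"
  then have "(fst e, snd e) \<in> parcs (T1 \<box> T2)" by simp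
  then show "fst e \<in> pverts (T1 \<box> T2)" "snd e \<in> pverts (T1 \<box> T2)"
    unfolding parcs_cart_prod_iff using T1.in_arcsD1 T1.in_arcsD2 T2.in_arcsD1 T2.in_arcsD2
    by (auto simp: mem_Times_iff)
qed

lemma tree_edge_dist:
  "(fst x, fst y) \<in> parcs T1 \<Longrightarrow> tree_edge (pverts (T1 \<box> T2)) D1 x y"
  "(snd x, snd y) \<in> parcs T2 \<Longrightarrow> tree_edge (pverts (T1 \<box> T2)) D2 x y"
  unfolding D1_def D2_def by (rule T1.tree_edge_pullback T2.tree_edge_pullback; auto)+

sublocale prod: tree_product "T1 \<box> T2" D1 D2
proof
  fix x y z :: "'a \<times> 'b"
  assume x: "x \<in> pverts (T1 \<box> T2)"
  show "D1 x x = 0" "D2 x x = 0" using x by (auto simp: D1_def D2_def)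
  assume y: "y \<in> pverts (T1 \<box> T2)"
  show "x = y" if "D1 x y = 0" "D2 x y = 0"
    using that x y by (auto simp: D1_def D2_def)
  show "D1 x y = D1 y x" "D2 x y = D2 y x"
    using x y T1.graph_dist_sym[of "fst x" "fst y"] T2.graph_dist_sym[of "snd x" "snd y"]
    by (auto simp: D1_def D2_def)
  show "\<exists>w. (x, w) \<in> parcs (T1 \<box> T2) \<and> D1 x y = Suc (D1 w y) \<and> static_edge (pverts (T1 \<box> T2)) D2 x w"
    if "0 < D1 x y"
  proof -
    have "fst x \<noteq> fst y" using that x by (auto simp: D1_def)
    then obtain w where "(fst x, w) \<in> parcs T1" "graph_dist T1 (fst x) (fst y) = Suc (graph_dist T1 w (fst y))"
      using T1.graph_dist_step[of "fst x" "fst y"] x y by auto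
    then show ?thesis
      using x by (intro exI[of _ "(w, snd x)"]) (auto simp: parcs_cart_prod_iff static_edge_def D1_def D2_def)
  qed
  show "\<exists>w. (x, w) \<in> parcs (T1 \<box> T2) \<and> D2 x y = Suc (D2 w y) \<and> static_edge (pverts (T1 \<box> T2)) D1 x w"
    if "0 < D2 x y"
  proof -
    have "snd x \<noteq> snd y" using that x by (auto simp: D2_def)
    then obtain w where "(snd x, w) \<in> parcs T2" "graph_dist T2 (snd x) (snd y) = Suc (graph_dist T2 w (snd y))"
      using T2.graph_dist_step[of "snd x" "snd y"] x y by auto
    then show ?thesis
      using x by (intro exI[of _ "(fst x, w)"]) (auto simp: parcs_cart_prod_iff static_edge_def D1_def D2_def)
  qed
  assume z: "z \<in> pverts (T1 \<box> T2)"
  show "D1 x z \<le> D1 x y + D1 y z" "D2 x z \<le> D2 x y + D2 y z"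
    using x y z T1.graph_dist_triangle T2.graph_dist_triangle by (auto simp: D1_def D2_def)
next
  fix x y assume "(x, y) \<in> parcs (T1 \<box> T2)"
  then show "tree_edge (pverts (T1 \<box> T2)) D1 x y \<and> static_edge (pverts (T1 \<box> T2)) D2 x y \<or>
      tree_edge (pverts (T1 \<box> T2)) D2 x y \<and> static_edge (pverts (T1 \<box> T2)) D1 x y"
    unfolding parcs_cart_prod_iff
    using tree_edge_dist[of x y] by (auto simp: static_edge_def D1_def D2_def)
qed

lemma graph_dist_cart_prod:
  assumes "x \<in> pverts (T1 \<box> T2)" "y \<in> pverts (T1 \<box> T2)"
  shows "graph_dist (T1 \<box> T2) x y = D1 x y + D2 x y"
proof (rule prod.graph_dist_eqI[OF assms])
  show "D1 y y + D2 y y = 0" using assms(2) by simp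
next
  fix u v assume e: "(u, v) \<in> parcs (T1 \<box> T2)"
  show "D1 u y + D2 u y \<le> Suc (D1 v y + D2 v y)"
    using prod.dist_edge[OF e assms(2)] prod.dist_sym[OF prod.in_arcsD1[OF e] assms(2)]
      prod.dist_sym[OF prod.in_arcsD2[OF e] assms(2)] by linarith
next
  fix u assume u: "u \<in> pverts (T1 \<box> T2)" "u \<noteq> y"
  show "\<exists>v. (u, v) \<in> parcs (T1 \<box> T2) \<and> D1 u y + D2 u y = Suc (D1 v y + D2 v y)"
    by (rule prod.step[OF u(1) assms(2) prod.dist_neq_0[OF u(1) assms(2) u(2)]])
qed

lemma diam_cart_prod: "diam (T1 \<box> T2) = diam T1 + diam T2"
proof -
  let ?S = "{graph_dist (T1 \<box> T2) u v | u v. u \<in> pverts (T1 \<box> T2) \<and> v \<in> pverts (T1 \<box> T2)}"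
  let ?V = "pverts (T1 \<box> T2)"
  have "?S = (\<lambda>(u, v). graph_dist (T1 \<box> T2) u v) ` (?V \<times> ?V)" by auto
  then have fin: "finite ?S" using T1.pair_finite_verts T2.pair_finite_verts by simp
  obtain p1 q1 p2 q2 where ends: "p1 \<in> pverts T1" "q1 \<in> pverts T1" "graph_dist T1 p1 q1 = diam T1"
    "p2 \<in> pverts T2" "q2 \<in> pverts T2" "graph_dist T2 p2 q2 = diam T2"
    using T1.diam_attained T2.diam_attained by blast
  show ?thesis
    unfolding diam_def[of "T1 \<box> T2"]
  proof (rule Max_eqI[OF fin])
    fix n assume "n \<in> ?S"
    then obtain u v where "u \<in> ?V" "v \<in> ?V" "n = D1 u v + D2 u v"
      using graph_dist_cart_prod by blast
    then show "n \<le> diam T1 + diam T2"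
      by (auto simp: D1_def D2_def intro!: add_mono T1.graph_dist_le_diam T2.graph_dist_le_diam)
  next
    have "diam T1 + diam T2 = graph_dist (T1 \<box> T2) (p1, p2) (q1, q2)"
      using ends by (simp add: graph_dist_cart_prod D1_def D2_def)
    then show "diam T1 + diam T2 \<in> ?S" using ends by auto
  qed
qed

section \<open>Upper bound: two cops at the centre\<close>

lemma cops_capture_within_half_diam:
  assumes "diam T1 > 0" "diam T2 > 0"
  shows "cops_capture_within (T1 \<box> T2) 2 ((diam T1 + diam T2) div 2)" (is "cops_capture_within _ _ ?m")
proof -
  obtain c1 c1' where c1: "(c1, c1') \<in> parcs T1"
    "\<And>x. x \<in> pverts T1 \<Longrightarrow> graph_dist T1 c1 x \<le> (diam T1 + 1) div 2"
    "\<And>x. x \<in> pverts T1 \<Longrightarrow> graph_dist T1 c1' x \<le> diam T1 div 2 + 1"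
    using T1.exists_center_edge[OF assms(1)] by blast
  obtain c2 c2' where c2: "(c2, c2') \<in> parcs T2"
    "\<And>x. x \<in> pverts T2 \<Longrightarrow> graph_dist T2 c2 x \<le> (diam T2 + 1) div 2"
    "\<And>x. x \<in> pverts T2 \<Longrightarrow> graph_dist T2 c2' x \<le> diam T2 div 2 + 1"
    using T2.exists_center_edge[OF assms(2)] by blast
  \<comment> \<open>For odd \<open>diam T1\<close>, replacing \<open>c1\<close> by
    \<open>c1'\<close> does not worsen the bound. For even \<open>diam T1\<close>, \<open>?m\<close>
    is \<open>diam T1 div 2 + diam T2 div 2\<close>, and the extra unit caused by \<open>c2'\<close>
    fits into \<open>Suc ?m\<close>.\<close>
  define B where "B = (if odd (diam T1) then (c1', c2) else (c1, c2'))"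
  have AB: "((c1, c2), B) \<in> parcs (T1 \<box> T2)"
    using c1(1) c2(1) T1.in_arcsD1 T2.in_arcsD1 by (auto simp: B_def parcs_cart_prod_iff)
  have eccA: "D1 (c1, c2) v + D2 (c1, c2) v \<le> Suc ?m" if "v \<in> pverts (T1 \<box> T2)" for v
    using c1(2)[of "fst v"] c2(2)[of "snd v"] that by (auto simp: D1_def D2_def)
  have eccB: "D1 B v + D2 B v \<le> Suc ?m" if v: "v \<in> pverts (T1 \<box> T2)" for v
  proof (cases "odd (diam T1)")
    case True
    then obtain h where "diam T1 = 2 * h + 1" by (elim oddE)
    moreover have "D1 B v \<le> diam T1 div 2 + 1" "D2 B v \<le> (diam T2 + 1) div 2"
      using c1(3)[of "fst v"] c2(2)[of "snd v"] v True by (auto simp: B_def D1_def D2_def)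
    ultimately show ?thesis by simp
  next
    case False
    then obtain h where "diam T1 = 2 * h" by (auto elim: evenE)
    moreover have "D1 B v \<le> (diam T1 + 1) div 2" "D2 B v \<le> diam T2 div 2 + 1"
      using c1(2)[of "fst v"] c2(3)[of "snd v"] v False by (auto simp: B_def D1_def D2_def)
    ultimately show ?thesis by simp
  qed
  show ?thesis
  proof (rule cops_capture_within_if_cops_win)
    show "length [(c1, c2), B] = 2" by simp
    show "set [(c1, c2), B] \<subseteq> pverts (T1 \<box> T2)"
      using prod.in_arcsD1[OF AB] prod.in_arcsD2[OF AB] by simp
    show "cops_win (T1 \<box> T2) ?m [(c1, c2), B] r" if "r \<in> pverts (T1 \<box> T2)" for r
      by (rule prod.adjacent_cops_win[OF AB that _ eccA eccB]) (use assms in auto)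
  qed
qed

section \<open>Lower bound: the robber in a corner of a diametral grid\<close>

lemma robber_escapes_at_corner:
  assumes u1: "u1 \<in> pverts T1" "v1 \<in> pverts T1" "graph_dist T1 u1 v1 = diam T1"
    and u2: "u2 \<in> pverts T2" "v2 \<in> pverts T2" "graph_dist T2 u2 v2 = diam T2"
    and pos: "diam T1 > 0" "diam T2 > 0"
    and AB: "A \<in> pverts (T1 \<box> T2)" "B \<in> pverts (T1 \<box> T2)" "A \<noteq> (u1, u2)" "B \<noteq> (u1, u2)"
    and T: "2 * Suc T \<le> graph_dist T1 u1 (fst A) + graph_dist T2 u2 (snd A)
      + (graph_dist T1 u1 (fst B) + graph_dist T2 u2 (snd B))"
  shows "\<exists>r \<in> pverts (T1 \<box> T2). \<not> cops_win (T1 \<box> T2) T [A, B] r"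
proof -
  define P1 where "P1 = {x \<in> pverts T1. graph_dist T1 u1 v1 = graph_dist T1 u1 x + graph_dist T1 x v1}"
  define P2 where "P2 = {x \<in> pverts T2. graph_dist T2 u2 v2 = graph_dist T2 u2 x + graph_dist T2 x v2}"
  define b where "b x = graph_dist T1 u1 (fst x) + graph_dist T2 u2 (snd x)" for x
  have bD: "b x = D1 (u1, u2) x + D2 (u1, u2) x" for x
    by (simp add: b_def D1_def D2_def)
  have zV: "(u1, u2) \<in> pverts (T1 \<box> T2)" using u1 u2 by simp
  have up1: "\<exists>w \<in> P1. (x, w) \<in> parcs T1 \<and> graph_dist T1 u1 w = Suc (graph_dist T1 u1 x)"
    if "x \<in> P1" "x \<noteq> v1" for x
    using T1.geodesic_step[OF u1(1,2), of x] that T1.in_arcsD2 unfolding P1_def by blast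
  have up2: "\<exists>w \<in> P2. (x, w) \<in> parcs T2 \<and> graph_dist T2 u2 w = Suc (graph_dist T2 u2 x)"
    if "x \<in> P2" "x \<noteq> v2" for x
    using T2.geodesic_step[OF u2(1,2), of x] that T2.in_arcsD2 unfolding P2_def by blast
  have down1: "\<exists>w \<in> P1. (x, w) \<in> parcs T1 \<and> graph_dist T1 u1 x = Suc (graph_dist T1 u1 w)"
    if x: "x \<in> P1" "x \<noteq> u1" for x
  proof -
    have xV: "x \<in> pverts T1" using x by (simp add: P1_def)
    \<comment> \<open>Descending towards \<open>u1\<close> is a geodesic step on the reversed path,
      which starts at \<open>v1\<close>.\<close>
    have "graph_dist T1 v1 u1 = graph_dist T1 v1 x + graph_dist T1 x u1"
      using x u1 T1.graph_dist_sym[of v1] T1.graph_dist_sym[of x u1] by (simp add: P1_def)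
    from T1.geodesic_step[OF u1(2,1) xV x(2) this] obtain w where w: "(x, w) \<in> parcs T1"
      "graph_dist T1 v1 w = Suc (graph_dist T1 v1 x)"
      "graph_dist T1 v1 u1 = graph_dist T1 v1 w + graph_dist T1 w u1" by blast
    have wV: "w \<in> pverts T1" using w(1) T1.in_arcsD2 by blast
    note s = T1.graph_dist_sym[OF u1(1) wV] T1.graph_dist_sym[OF u1(2) wV]
      T1.graph_dist_sym[OF u1(1) xV] T1.graph_dist_sym[OF u1(2) xV] T1.graph_dist_sym[OF u1(1,2)]
    have "w \<in> P1 \<and> graph_dist T1 u1 x = Suc (graph_dist T1 u1 w)"
      using w(2,3) s x(1) wV unfolding P1_def by simp
    then show ?thesis using w(1) by blast
  qed
  have down2: "\<exists>w \<in> P2. (x, w) \<in> parcs T2 \<and> graph_dist T2 u2 x = Suc (graph_dist T2 u2 w)"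
    if x: "x \<in> P2" "x \<noteq> u2" for x
  proof -
    have xV: "x \<in> pverts T2" using x by (simp add: P2_def)
    have "graph_dist T2 v2 u2 = graph_dist T2 v2 x + graph_dist T2 x u2"
      using x u2 T2.graph_dist_sym[of v2] T2.graph_dist_sym[of x u2] by (simp add: P2_def)
    from T2.geodesic_step[OF u2(2,1) xV x(2) this] obtain w where w: "(x, w) \<in> parcs T2"
      "graph_dist T2 v2 w = Suc (graph_dist T2 v2 x)"
      "graph_dist T2 v2 u2 = graph_dist T2 v2 w + graph_dist T2 w u2" by blast
    have wV: "w \<in> pverts T2" using w(1) T2.in_arcsD2 by blast
    note s = T2.graph_dist_sym[OF u2(1) wV] T2.graph_dist_sym[OF u2(2) wV]
      T2.graph_dist_sym[OF u2(1) xV] T2.graph_dist_sym[OF u2(2) xV] T2.graph_dist_sym[OF u2(1,2)]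
    have "w \<in> P2 \<and> graph_dist T2 u2 x = Suc (graph_dist T2 u2 w)"
      using w(2,3) s x(1) wV unfolding P2_def by simp
    then show ?thesis using w(1) by blast
  qed
  have P1V: "x \<in> pverts T1" if "x \<in> P1" for x using that by (simp add: P1_def)
  have P2V: "x \<in> pverts T2" if "x \<in> P2" for x using that by (simp add: P2_def)
  have arc1: "(x, (w, snd x)) \<in> parcs (T1 \<box> T2)" if "x \<in> P1 \<times> P2" "(fst x, w) \<in> parcs T1" for x w
    using that P2V by (auto simp: parcs_cart_prod_iff)
  have arc2: "(x, (fst x, w)) \<in> parcs (T1 \<box> T2)" if "x \<in> P1 \<times> P2" "(snd x, w) \<in> parcs T2" for x w
    using that P1V by (auto simp: parcs_cart_prod_iff)
  interpret cornered_grid "T1 \<box> T2" "P1 \<times> P2" b "diam T1 + diam T2"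
  proof
    show "P1 \<times> P2 \<subseteq> pverts (T1 \<box> T2)" using P1V P2V by auto
  next
    fix x y assume "(x, y) \<in> parcs (T1 \<box> T2)"
    then show "b y = Suc (b x) \<or> b x = Suc (b y)"
      unfolding bD by (rule prod.dist_edge[OF _ zV])
  next
    fix x assume "x \<in> pverts (T1 \<box> T2)"
    then show "b x \<le> diam T1 + diam T2"
      using T1.graph_dist_le_diam T2.graph_dist_le_diam u1 u2 by (auto simp: b_def intro!: add_mono)
  next
    fix x assume x: "x \<in> P1 \<times> P2" "b x < diam T1 + diam T2"
    then have "fst x \<noteq> v1 \<or> snd x \<noteq> v2" using u1 u2 by (auto simp: b_def)
    then show "\<exists>y \<in> P1 \<times> P2. (x, y) \<in> parcs (T1 \<box> T2) \<and> b y = Suc (b x)"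
    proof
      assume "fst x \<noteq> v1"
      then obtain w where "w \<in> P1" "(fst x, w) \<in> parcs T1" "graph_dist T1 u1 w = Suc (graph_dist T1 u1 (fst x))"
        using up1[of "fst x"] x by auto
      then show ?thesis using arc1 x(1) by (intro bexI[of _ "(w, snd x)"]) (auto simp: b_def)
    next
      assume "snd x \<noteq> v2"
      then obtain w where "w \<in> P2" "(snd x, w) \<in> parcs T2" "graph_dist T2 u2 w = Suc (graph_dist T2 u2 (snd x))"
        using up2[of "snd x"] x by auto
      then show ?thesis using arc2 x(1) by (intro bexI[of _ "(fst x, w)"]) (auto simp: b_def)
    qed
  next
    fix x assume x: "x \<in> P1 \<times> P2" "0 < b x"
    then have "fst x \<noteq> u1 \<or> snd x \<noteq> u2" using u1 u2 by (auto simp: b_def)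
    then show "\<exists>y \<in> P1 \<times> P2. (x, y) \<in> parcs (T1 \<box> T2) \<and> b x = Suc (b y)"
    proof
      assume "fst x \<noteq> u1"
      then obtain w where "w \<in> P1" "(fst x, w) \<in> parcs T1" "graph_dist T1 u1 (fst x) = Suc (graph_dist T1 u1 w)"
        using down1[of "fst x"] x by auto
      then show ?thesis using arc1 x(1) by (intro bexI[of _ "(w, snd x)"]) (auto simp: b_def)
    next
      assume "snd x \<noteq> u2"
      then obtain w where "w \<in> P2" "(snd x, w) \<in> parcs T2" "graph_dist T2 u2 (snd x) = Suc (graph_dist T2 u2 w)"
        using down2[of "snd x"] x by auto
      then show ?thesis using arc2 x(1) by (intro bexI[of _ "(fst x, w)"]) (auto simp: b_def)
    qed
  next
    fix x a assume x: "x \<in> P1 \<times> P2" "b x = 0"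
    then have "fst x = u1" "snd x = u2" using P1V P2V u1(1) u2(1) by (auto simp: b_def)
    \<comment> \<open>Positive diameters provide one exit in each factor; the two exits differ, so
      one of them avoids \<open>a\<close>.\<close>
    moreover have "u1 \<noteq> v1" "u2 \<noteq> v2" using u1 u2 pos by auto
    ultimately obtain w1 w2 where w: "w1 \<in> P1" "(fst x, w1) \<in> parcs T1"
      "graph_dist T1 u1 w1 = Suc (graph_dist T1 u1 (fst x))"
      "w2 \<in> P2" "(snd x, w2) \<in> parcs T2" "graph_dist T2 u2 w2 = Suc (graph_dist T2 u2 (snd x))"
      using up1[of "fst x"] up2[of "snd x"] x(1) by auto
    then have "(w1, snd x) \<noteq> (fst x, w2)" using T1.parcs_irrefl by blast
    moreover have "(w1, snd x) \<in> P1 \<times> P2" "(x, (w1, snd x)) \<in> parcs (T1 \<box> T2)" "b (w1, snd x) = 1"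
      "(fst x, w2) \<in> P1 \<times> P2" "(x, (fst x, w2)) \<in> parcs (T1 \<box> T2)" "b (fst x, w2) = 1"
      using w x arc1 arc2 by (auto simp: b_def)
    ultimately show "\<exists>y \<in> P1 \<times> P2. (x, y) \<in> parcs (T1 \<box> T2) \<and> b y = 1 \<and> y \<noteq> a"
      by metis
  qed
  have "b x \<noteq> 0" if "x \<in> pverts (T1 \<box> T2)" "x \<noteq> (u1, u2)" for x
    unfolding bD by (rule prod.dist_neq_0[OF zV that(1) that(2)[symmetric]])
  then have "0 < b A" "0 < b B" using AB by auto
  then show ?thesis
    using robber_survives_from_corner[of "(u1, u2)" A B T] AB T u1 u2
    by (simp add: b_def P1_def P2_def)
qed

text \<open>The waiting corner must also be free of cops. If just one of two opposite corners is
  occupied, the other one is at full distance from the cop there and suffices.\<close>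

lemma robber_escapes:
  assumes pos: "diam T1 > 0" "diam T2 > 0"
    and AB: "A \<in> pverts (T1 \<box> T2)" "B \<in> pverts (T1 \<box> T2)"
    and T: "2 * Suc T \<le> diam T1 + diam T2"
  shows "\<exists>r \<in> pverts (T1 \<box> T2). \<not> cops_win (T1 \<box> T2) T [A, B] r"
proof -
  obtain p1 q1 p2 q2 where ends: "p1 \<in> pverts T1" "q1 \<in> pverts T1" "graph_dist T1 p1 q1 = diam T1"
    "p2 \<in> pverts T2" "q2 \<in> pverts T2" "graph_dist T2 p2 q2 = diam T2"
    using T1.diam_attained T2.diam_attained by blast
  have ends': "graph_dist T1 q1 p1 = diam T1" "graph_dist T2 q2 p2 = diam T2"
    using ends T1.graph_dist_sym[of p1 q1] T2.graph_dist_sym[of p2 q2] by auto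
  define b where "b z x = graph_dist T1 (fst z) (fst x) + graph_dist T2 (snd z) (snd x)"
    for z x :: "'a \<times> 'b"
  have corner: ?thesis
    if "z \<in> {(p1, p2), (q1, q2), (p1, q2), (q1, p2)}" "A \<noteq> z" "B \<noteq> z" "2 * Suc T \<le> b z A + b z B" for z
    using that robber_escapes_at_corner[OF ends(1,2,3) ends(4,5,6) pos AB, of T]
      robber_escapes_at_corner[OF ends(2,1) ends'(1) ends(5,4) ends'(2) pos AB, of T]
      robber_escapes_at_corner[OF ends(1,2,3) ends(5,4) ends'(2) pos AB, of T]
      robber_escapes_at_corner[OF ends(2,1) ends'(1) ends(4,5,6) pos AB, of T]
    unfolding b_def by auto
  have opposite: "diam T1 + diam T2 \<le> b (p1, p2) x + b (q1, q2) x" if "x \<in> pverts (T1 \<box> T2)" for x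
    using that ends T1.graph_dist_triangle[of p1 "fst x" q1] T2.graph_dist_triangle[of p2 "snd x" q2]
      T1.graph_dist_sym[of q1 "fst x"] T2.graph_dist_sym[of q2 "snd x"]
    by (auto simp: b_def)
  have ne: "p1 \<noteq> q1" "p2 \<noteq> q2" using ends pos by auto
  have full: "b (p1, p2) (q1, q2) = diam T1 + diam T2" "b (q1, q2) (p1, p2) = diam T1 + diam T2"
    "b (p1, q2) (p1, p2) + b (p1, q2) (q1, q2) = diam T1 + diam T2"
    using ends ends' by (auto simp: b_def)
  consider "{A, B} = {(p1, p2), (q1, q2)}"
    | "(p1, p2) \<in> {A, B}" "(q1, q2) \<notin> {A, B}" | "(q1, q2) \<in> {A, B}" "(p1, p2) \<notin> {A, B}"
    | "(p1, p2) \<notin> {A, B}" "(q1, q2) \<notin> {A, B}"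
    using ne by auto
  then show ?thesis
  proof cases
    \<comment> \<open>A third corner is free: one cop is at distance \<open>diam T2\<close> from it,
      the other at distance \<open>diam T1\<close>.\<close>
    case 1
    then show ?thesis using corner[of "(p1, q2)"] full(3) T ne by (auto simp: doubleton_eq_iff)
  next
    case 2
    then show ?thesis using corner[of "(q1, q2)"] full(2) T ne by auto
  next
    case 3
    then show ?thesis using corner[of "(p1, p2)"] full(1) T ne by auto
  next
    case 4
    have "2 * Suc T \<le> b (p1, p2) A + b (p1, p2) B \<or> 2 * Suc T \<le> b (q1, q2) A + b (q1, q2) B"
      using opposite[OF AB(1)] opposite[OF AB(2)] T by linarith
    then show ?thesis using corner[of "(p1, p2)"] corner[of "(q1, q2)"] 4 by auto
  qed
qed

lemma capture_time_cart_prod: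
  assumes "diam T1 > 0" "diam T2 > 0"
  shows "capture_time 2 (T1 \<box> T2) = enat (diam (T1 \<box> T2) div 2)"
  unfolding capture_time_def diam_cart_prod
proof (rule antisym)
  show "Inf {enat t | t. cops_capture_within (T1 \<box> T2) 2 t} \<le> enat ((diam T1 + diam T2) div 2)"
    using cops_capture_within_half_diam[OF assms] by (intro Inf_lower) blast
  show "enat ((diam T1 + diam T2) div 2) \<le> Inf {enat t | t. cops_capture_within (T1 \<box> T2) 2 t}"
  proof (rule Inf_greatest, clarify)
    fix t assume t: "cops_capture_within (T1 \<box> T2) 2 t"
    have "pverts (T1 \<box> T2) \<noteq> {}" using T1.pverts_nonempty T2.pverts_nonempty by simp
    from cops_win_if_cops_capture_within[OF t this] obtain c where
      c: "length c = 2" "set c \<subseteq> pverts (T1 \<box> T2)" "\<And>r. r \<in> pverts (T1 \<box> T2) \<Longrightarrow> cops_win (T1 \<box> T2) t c r"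
      by blast
    then obtain A B where "c = [A, B]" by (auto simp: length_Suc_conv numeral_2_eq_2)
    with c have "\<not> 2 * Suc t \<le> diam T1 + diam T2"
      using robber_escapes[OF assms, of A B t] by auto
    then show "enat ((diam T1 + diam T2) div 2) \<le> enat t" by simp
  qed
qed

end

theorem theorem2:
  fixes T1 :: "'a pair_pre_digraph" and T2 :: "'b pair_pre_digraph"
  assumes "undirected_tree T1" and "undirected_tree T2"
    and "diam T1 > 0" and "diam T2 > 0"
  shows "capture_time 2 (T1 \<box> T2) = enat (diam (T1 \<box> T2) div 2)"
proof -
  interpret two_trees T1 T2
    using assms(1,2) by (simp add: two_trees_def undirected_tree_iff)
  show ?thesis
    by (rule capture_time_cart_prod[OF assms(3,4)])
qed

end
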